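(* Let $s\in\{1,\dots,p\}$. Assume that the condition $WRE(s,7)$ holds for $\mathbb X$. Let $\hat{\boldsymbol\beta}$ be the Slope estimator with weights $\lambda_j=A\sigma\sqrt{\log(2p/j)/n}$, $j=1,\dots,p$, where $A\ge2(4+\sqrt2)$. Then $$\mathbb E\left[\frac12|\hat{\boldsymbol\beta}-\boldsymbol\beta|_*+\|\mathbb X\hat{\boldsymbol\beta}-\mathbf f\|_n^2\right]\le\|\mathbb X\boldsymbol\beta-\mathbf f\|_n^2+\frac{49\sum_{j=1}^s\lambda_j^2}{16}\left(\frac1{\vartheta^2(s,7)}+\frac1{2\log(2p)}\right)$$ for all $\boldsymbol\beta\in\mathbb R^p$ such that $|\boldsymbol\beta|_0\le s$, and all $\mathbf f\in\mathbb R^n$. Furthermore, if $\mathbf f=\mathbb X\boldsymbol\beta^*$ for some $\boldsymbol\beta^*\in\mathbb R^p$ with $|\boldsymbol\beta^*|_0\le s$, then $$\mathbb E\left[|\hat{\boldsymbol\beta}-\boldsymbol\beta^*|_2^2\right]\le\frac{9\sum_{j=1}^s\lambda_j^2}4\left(\frac1{\vartheta^4(s,3)}+\frac1{(\log(2p))^2}\right).$$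
   Context: Let $n,p\ge1$ be integers, $\sigma>0$, $\mathbb X\in\mathbb R^{n\times p}$ a deterministic matrix, $\mathbf f\in\mathbb R^n$ deterministic, $\boldsymbol\xi\sim\mathcal N(\mathbf 0,\sigma^2I_{n\times n})$, $\mathbf y=\mathbf f+\boldsymbol\xi$. $\|\boldsymbol u\|_n^2=\frac1n\sum_{i=1}^nu_i^2$ for $\boldsymbol u\in\mathbb R^n$; $|\cdot|_q$ is the $\ell_q$ norm on $\mathbb R^p$; $|\boldsymbol\beta|_0$ is the number of nonzero components; $(\boldsymbol e_j)$ is the canonical basis of $\mathbb R^p$. For $\boldsymbol\beta\in\mathbb R^p$, $\beta_1^\sharp\ge\dots\ge\beta_p^\sharp$ is a non-increasing rearrangement of $|\beta_1|,\dots,|\beta_p|$. Sorted $\ell_1$ norm: $|\boldsymbol\beta|_*=\sum_{j=1}^p\lambda_j\beta_j^\sharp$. Slope estimator with weights $\lambda_1\ge\dots\ge\lambda_p\ge0$: any $\hat{\boldsymbol\beta}\in\arg\min_{\boldsymbol\beta\in\mathbb R^p}\big(\|\mathbb X\boldsymbol\beta-\mathbf y\|_n^2+2|\boldsymbol\beta|_*\big)$. Condition $WRE(s,c_0)$ ($c_0>0$, with the weights $\lambda_j$): $\|\mathbb X\boldsymbol e_j\|_n\le1$ for all $j=1,\dots,p$, and $$\vartheta(s,c_0)=\min_{\boldsymbol\delta\in\mathcal C_{WRE}(s,c_0),\,\boldsymbol\delta\ne\mathbf 0}\frac{\|\mathbb X\boldsymbol\delta\|_n}{|\boldsymbol\delta|_2}>0,\qquad\mathcal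 C_{WRE}(s,c_0)=\Big\{\boldsymbol\delta\in\mathbb R^p:|\boldsymbol\delta|_*\le(1+c_0)|\boldsymbol\delta|_2\sqrt{\textstyle\sum_{j=1}^s\lambda_j^2}\Big\}.$$ *)

theory Defs
  imports "HOL-Probability.Probability"
begin

definition emp_norm :: "real ^ 'n \<Rightarrow> real" where
  "emp_norm u = sqrt (1 / real CARD('n) * (\<Sum>i\<in>UNIV. (u $ i)\<^sup>2))"

definition l0 :: "real ^ 'p \<Rightarrow> nat" where
  "l0 b = card {j. b $ j \<noteq> 0}"

(* Meaningful for 1 \<le> j \<le> CARD('p): the j-th largest absolute component, with multiplicity. *)
definition sharp :: "real ^ 'p \<Rightarrow> nat \<Rightarrow> real" where
  "sharp b j =
     rev (sorted_list_of_multiset (image_mset (\<lambda>i. \<bar>b $ i\<bar>) (mset_set UNIV))) ! (j - 1)"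

definition sorted_l1 :: "(nat \<Rightarrow> real) \<Rightarrow> real ^ 'p \<Rightarrow> real" where
  "sorted_l1 lam b = (\<Sum>j = 1..CARD('p). lam j * sharp b j)"

definition is_slope :: "real ^ 'p ^ 'n \<Rightarrow> (nat \<Rightarrow> real) \<Rightarrow> real ^ 'n \<Rightarrow> real ^ 'p \<Rightarrow> bool" where
  "is_slope X lam y b \<longleftrightarrow>
     is_arg_min (\<lambda>b. (emp_norm (X *v b - y))\<^sup>2 + 2 * sorted_l1 lam b) (\<lambda>_. True) b"

definition C_WRE :: "(nat \<Rightarrow> real) \<Rightarrow> nat \<Rightarrow> real \<Rightarrow> (real ^ 'p) set" where
  "C_WRE lam s c0 =
     {d. sorted_l1 lam d \<le> (1 + c0) * norm d * sqrt (\<Sum>j = 1..s. (lam j)\<^sup>2)}"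

(* The infimum is a minimum: the quotient is invariant under scaling of d, and the cone is closed.
   For s \<ge> 1, c0 \<ge> 0 and nonnegative non-increasing weights the cone contains every
   canonical basis vector, so the infimum is never over the empty set. *)
definition theta :: "real ^ 'p ^ 'n \<Rightarrow> (nat \<Rightarrow> real) \<Rightarrow> nat \<Rightarrow> real \<Rightarrow> real" where
  "theta X lam s c0 = (INF d\<in>C_WRE lam s c0 - {0}. emp_norm (X *v d) / norm d)"

definition WRE :: "real ^ 'p ^ 'n \<Rightarrow> (nat \<Rightarrow> real) \<Rightarrow> nat \<Rightarrow> real \<Rightarrow> bool" where
  "WRE X lam s c0 \<longleftrightarrow> (\<forall>j. emp_norm (X *v axis j 1) \<le> 1) \<and> theta X lam s c0 > 0"

(* xi has law N(0, sigma^2 I): its components are i.i.d. N(0, sigma^2); the second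
   argument of normal_density is the standard deviation. *)
definition gaussian_noise :: "'a measure \<Rightarrow> real \<Rightarrow> ('a \<Rightarrow> real ^ 'n) \<Rightarrow> bool" where
  "gaussian_noise M \<sigma> \<xi> \<longleftrightarrow>
     prob_space.indep_vars M (\<lambda>_. borel) (\<lambda>i \<omega>. \<xi> \<omega> $ i) UNIV \<and>
     (\<forall>i. distributed M lborel (\<lambda>\<omega>. \<xi> \<omega> $ i) (normal_density 0 \<sigma>))"

end

theory Submission imports Defs begin

text \<open>
  Let \<open>u\<close> be the estimation error \<open>bhat - \<beta>\<close>, let \<open>N\<close> be the sorted norm with the weights
  \<open>sqrt (ln (2p/j))\<close>, so that the Slope penalty is \<open>(A \<sigma> / sqrt n) N\<close>, and let \<open>L\<^sup>2\<close> be the sum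
  of the \<open>s\<close> largest squared weights of the penalty. The Slope objective is a squared norm plus a
  convex function; minimality therefore gives \<open>slope_basic_inequality\<close>, where the noise enters
  only through the inner product \<open>\<xi> \<bullet> X u\<close>, and where sparsity of \<open>\<beta>\<close> bounds the change of the
  penalty by the contribution of the \<open>s\<close> largest components of \<open>u\<close> minus that of the others
  (\<open>sorted_l1_decrease\<close>).

  The noise is handled by a set of tame vectors \<open>k\<close>, those with \<open>k \<bullet> X u \<le> 4 sqrt n N u\<close> for all
  \<open>u\<close>. The standardized noise \<open>z\<close> is tame with probability at least \<open>31/32\<close>: by the rearrangement
  inequality it is enough that the order statistics of the \<open>p\<close> correlated Gaussian variables
  \<open>z \<bullet> X e\<^sub>j / sqrt n\<close> are below \<open>4 sqrt (ln (2p/j))\<close>, and one exponential moment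
  controls them all (\<open>prob_tame_noise\<close>). When \<open>z\<close> is not tame, replacing it by the nearest tame
  vector, at distance \<open>d\<close>, costs at most \<open>d\<close> times the Euclidean norm of \<open>X u\<close>. With
  \<open>T = d\<^sup>2 / 2\<close> the noise term is thus at most \<open>(4 + sqrt 2) \<sigma> / sqrt n\<close> times the maximum of
  \<open>N u\<close> and \<open>sqrt T\<close> times the empirical norm of \<open>X u\<close>. If the first term is the larger one, half
  of the penalty absorbs the noise and the error is either harmless or in the WRE cone. If the second is,
  the inequality \<open>sqrt (ln (2p)) |u|\<^sub>2 \<le> N u\<close> takes the place of the WRE condition, and
  \<open>T / ln (2p)\<close> takes the place of \<open>1 / \<theta>\<^sup>2\<close>. Hence for every realization of the noise both error
  bounds hold with \<open>1 / \<theta>\<^sup>2 + T / ln (2p)\<close> and \<open>1 / \<theta>\<^sup>4 + (T / ln (2p))\<^sup>2\<close>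
  (\<open>slope_pathwise_bounds\<close>).

  It remains to see that \<open>T\<close> has mean at most \<open>1/2\<close> and second moment at most \<open>1\<close>. This is Gaussian
  concentration. Maurey's inequality \<open>E (exp (d\<^sup>2 / 4)) * P (z tame) \<le> 1\<close> is an instance of an
  infimum-convolution inequality, which passes from one dimension to any number of dimensions by
  Fubini's theorem and which in dimension one is the Prekopa-Leindler inequality for the normal
  density (\<open>gaussian_inf_convolution\<close>, \<open>gaussian_distance_to_set\<close>). As \<open>P (z tame)\<close> is close to
  one, \<open>exp (T / 2) - 1\<close> has a small mean, and so have \<open>T\<close> and \<open>T\<^sup>2\<close>.
\<close>

section \<open>The decreasing rearrangement of a vector\<close>

text \<open>The function \<open>sharp\<close> is defined through a sorted list; arguments about it are easier with an
  explicit enumeration \<open>e\<close> of the coordinates that lists the absolute values in decreasing order.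
  Ties make \<open>e\<close> non-unique, which is useful: one enumeration can sort several vectors.\<close>

definition sorts :: "(nat \<Rightarrow> 'p::finite) \<Rightarrow> real ^ 'p \<Rightarrow> bool" where
  "sorts e b \<longleftrightarrow> bij_betw e {1..CARD('p)} UNIV \<and>
     (\<forall>j\<in>{1..CARD('p)}. \<forall>i\<in>{1..j}. \<bar>b $ e j\<bar> \<le> \<bar>b $ e i\<bar>)"

lemma sorts_exists:
  fixes b :: "real ^ 'p"
  obtains e where "sorts e b"
proof -
  obtain xs :: "'p list" where xs: "set xs = UNIV" "distinct xs"
    using finite_distinct_list[OF finite] by blast
  define ys where "ys = sort_key (\<lambda>i. - \<bar>b $ i\<bar>) xs"
  have ys: "set ys = UNIV" "distinct ys" "sorted (map (\<lambda>i. - \<bar>b $ i\<bar>) ys)"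
    using xs by (auto simp: ys_def)
  have len: "length ys = CARD('p)"
    using ys distinct_card by metis
  define e where "e = (\<lambda>j. ys ! (j - 1))"
  have "bij_betw ((!) ys) {..<length ys} (set ys)"
    using ys by (intro bij_betw_nth) auto
  moreover have "bij_betw (\<lambda>j. j - 1) {1..CARD('p)} {..<CARD('p)}"
    by (rule bij_betw_byWitness[where f'=Suc]) auto
  ultimately have "bij_betw e {1..CARD('p)} UNIV"
    using ys len bij_betw_trans[of "\<lambda>j. j - 1" _ _ "(!) ys"] by (simp add: e_def comp_def)
  moreover have "\<bar>b $ e j\<bar> \<le> \<bar>b $ e i\<bar>" if "j \<in> {1..CARD('p)}" "i \<in> {1..j}" for i j
    using sorted_nth_mono[OF ys(3), of "i - 1" "j - 1"] that len by (auto simp: e_def)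
  ultimately have "sorts e b" by (auto simp: sorts_def)
  then show thesis by (rule that)
qed

lemma sortsD:
  fixes b :: "real ^ 'p"
  assumes "sorts e b"
  shows "bij_betw e {1..CARD('p)} UNIV"
    and "\<lbrakk>1 \<le> i; i \<le> j; j \<le> CARD('p)\<rbrakk> \<Longrightarrow> \<bar>b $ e j\<bar> \<le> \<bar>b $ e i\<bar>"
  using assms by (auto simp: sorts_def)

lemma sharp_eq_sorts:
  fixes b :: "real ^ 'p"
  assumes e: "sorts e b" and j: "1 \<le> j" "j \<le> CARD('p)"
  shows "sharp b j = \<bar>b $ e j\<bar>"
proof -
  let ?p = "CARD('p)"
  define xs where "xs = map (\<lambda>j. \<bar>b $ e j\<bar>) [1..<Suc ?p]"
  have "image_mset e (mset_set {1..?p}) = mset_set UNIV"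
    using sortsD(1)[OF e] by (simp add: bij_betw_def image_mset_mset_set)
  moreover have "mset [1..<Suc ?p] = mset_set {1..?p}"
    by (metis atLeastLessThanSuc_atLeastAtMost mset_upt)
  ultimately have m: "mset xs = image_mset (\<lambda>i. \<bar>b $ i\<bar>) (mset_set UNIV)"
    by (metis (no_types, lifting) image_mset.compositionality mset_map xs_def comp_def image_mset_cong)
  have "sorted (rev xs)"
    unfolding sorted_iff_nth_mono xs_def
    by (auto simp: rev_nth simp del: upt_Suc intro!: sortsD(2)[OF e])
  then have "rev xs = sorted_list_of_multiset (image_mset (\<lambda>i. \<bar>b $ i\<bar>) (mset_set UNIV))"
    by (metis m mset_rev sorted_list_of_multiset_mset sorted_sort_id)
  then have "sharp b j = xs ! (j - 1)"
    by (metis sharp_def rev_rev_ident)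
  also have "\<dots> = \<bar>b $ e j\<bar>"
    using j nth_upt[of 1 "j - 1" "Suc ?p"] by (simp add: xs_def del: upt_Suc)
  finally show ?thesis .
qed

lemma sharp_nonneg: "\<lbrakk>1 \<le> j; j \<le> CARD('p)\<rbrakk> \<Longrightarrow> 0 \<le> sharp (b :: real ^ 'p) j"
  by (metis abs_ge_zero sharp_eq_sorts sorts_exists)

lemma sharp_antimono:
  fixes b :: "real ^ 'p"
  assumes "1 \<le> i" "i \<le> j" "j \<le> CARD('p)"
  shows "sharp b j \<le> sharp b i"
proof -
  obtain e where "sorts e b" by (rule sorts_exists)
  with assms show ?thesis by (simp add: sharp_eq_sorts sortsD)
qed

lemma sum_sharp:
  fixes b :: "real ^ 'p" and h :: "real \<Rightarrow> real"
  shows "(\<Sum>j = 1..CARD('p). h (sharp b j)) = (\<Sum>i\<in>UNIV. h \<bar>b $ i\<bar>)"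
proof -
  obtain e where e: "sorts e b" by (rule sorts_exists)
  have "(\<Sum>j = 1..CARD('p). h (sharp b j)) = (\<Sum>j = 1..CARD('p). h \<bar>b $ e j\<bar>)"
    by (intro sum.cong) (auto simp: sharp_eq_sorts[OF e])
  also have "\<dots> = (\<Sum>i\<in>UNIV. h \<bar>b $ i\<bar>)"
    by (rule sum.reindex_bij_betw[OF sortsD(1)[OF e]])
  finally show ?thesis .
qed

lemma sum_sharp_sq: "(\<Sum>j = 1..CARD('p). (sharp b j)\<^sup>2) = (norm (b :: real ^ 'p))\<^sup>2"
  using sum_sharp[of power2 b] by (simp add: norm_vec_def L2_set_def sum_nonneg)

text \<open>If the \<open>j\<close>-th largest absolute value exceeded \<open>x\<close>, at least \<open>j\<close> of them would.\<close>

lemma sharp_le_if_few_above: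
  fixes b :: "real ^ 'p"
  assumes "1 \<le> j" "j \<le> CARD('p)" and "card {i. x < \<bar>b $ i\<bar>} < j"
  shows "sharp b j \<le> x"
proof (rule ccontr)
  assume "\<not> sharp b j \<le> x"
  then have x: "x < sharp b j" by simp
  obtain e where e: "sorts e b" by (rule sorts_exists)
  have "x < \<bar>b $ e i\<bar>" if "i \<in> {1..j}" for i
    using that assms x sharp_antimono[of i j b] by (simp add: sharp_eq_sorts[OF e, symmetric])
  then have "e ` {1..j} \<subseteq> {i. x < \<bar>b $ i\<bar>}" by blast
  then have "card (e ` {1..j}) \<le> card {i. x < \<bar>b $ i\<bar>}" by (intro card_mono) auto
  moreover have "inj_on e {1..j}"
    by (rule inj_on_subset[of e "{1..CARD('p)}"])
      (use assms sortsD(1)[OF e] in \<open>auto simp: bij_betw_def\<close>)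
  ultimately show False using assms by (simp add: card_image)
qed

text \<open>With the threshold \<open>t = sharp b (card I)\<close>, every \<open>|b\<^sub>i|\<close> is at most
  \<open>t + max 0 (|b\<^sub>i| - t)\<close>. Extending the sum of the positive parts from \<open>I\<close> to all coordinates makes
  it invariant under sorting, and after sorting only the first \<open>card I\<close> terms are nonzero.\<close>

lemma sum_le_sum_sharp:
  fixes b :: "real ^ 'p"
  shows "(\<Sum>i\<in>I. \<bar>b $ i\<bar>) \<le> (\<Sum>j = 1..card I. sharp b j)"
proof (cases "card I = 0")
  case False
  have k: "card I \<le> CARD('p)" by (simp add: card_mono)
  define t where "t = sharp b (card I)"
  have "(\<Sum>i\<in>I. \<bar>b $ i\<bar>) \<le> (\<Sum>i\<in>I. t + max 0 (\<bar>b $ i\<bar> - t))"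
    by (intro sum_mono) auto
  also have "\<dots> \<le> card I * t + (\<Sum>i\<in>UNIV. max 0 (\<bar>b $ i\<bar> - t))"
    by (auto simp: sum.distrib intro!: sum_mono2)
  also have "(\<Sum>i\<in>UNIV. max 0 (\<bar>b $ i\<bar> - t)) = (\<Sum>j = 1..CARD('p). max 0 (sharp b j - t))"
    by (rule sum_sharp[symmetric])
  also have "\<dots> = (\<Sum>j = 1..card I. sharp b j - t)"
  proof (rule sum.mono_neutral_cong_right)
    have "sharp b j \<le> t" if "j \<in> {1..CARD('p)} - {1..card I}" for j
      unfolding t_def using that False by (intro sharp_antimono) (auto simp: not_le)
    then show "\<forall>j\<in>{1..CARD('p)} - {1..card I}. max 0 (sharp b j - t) = 0"
      by (meson max.absorb1 diff_le_0_iff_le)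
    show "max 0 (sharp b j - t) = sharp b j - t" if "j \<in> {1..card I}" for j
      using that k sharp_antimono[of j "card I" b] by (auto simp: t_def)
  qed (use k in auto)
  finally show ?thesis by (simp add: sum_subtractf)
next
  case True then show ?thesis by auto
qed

section \<open>The sorted norm\<close>

text \<open>Summation by parts: with decreasing nonnegative weights, a weighted sum is a
  nonnegative combination of partial sums.\<close>

lemma sum_weighted_mono:
  fixes w a c :: "nat \<Rightarrow> real"
  assumes w0: "\<And>j. j \<in> {1..m} \<Longrightarrow> 0 \<le> w j"
    and w: "\<And>i j. \<lbrakk>1 \<le> i; i \<le> j; j \<le> m\<rbrakk> \<Longrightarrow> w j \<le> w i"
    and ac: "\<And>k. k \<in> {1..m} \<Longrightarrow> (\<Sum>j = 1..k. a j) \<le> (\<Sum>j = 1..k. c j)"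
  shows "(\<Sum>j = 1..m. w j * a j) \<le> (\<Sum>j = 1..m. w j * c j)"
proof -
  define D where "D = (\<lambda>k. \<Sum>j = 1..k. c j - a j)"
  have D: "0 \<le> D k" if "k \<in> {1..m}" for k
    using ac[OF that] by (simp add: D_def sum_subtractf)
  have *: "w k * D k \<le> (\<Sum>j = 1..k. w j * (c j - a j))" if "1 \<le> k" "k \<le> m" for k
    using that
  proof (induction k rule: dec_induct)
    case base then show ?case by (simp add: D_def)
  next
    case (step k)
    have "w (Suc k) * D (Suc k) = w (Suc k) * D k + w (Suc k) * (c (Suc k) - a (Suc k))"
      by (simp add: D_def algebra_simps)
    also have "w (Suc k) * D k \<le> w k * D k"
      using step by (intro mult_right_mono w D) auto
    also have "\<dots> \<le> (\<Sum>j = 1..k. w j * (c j - a j))"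
      using step by auto
    finally show ?case using step by simp
  qed
  show ?thesis
  proof (cases "1 \<le> m")
    case True
    then have "0 \<le> w m * D m" using w0 D by auto
    also note *[OF True order_refl]
    finally show ?thesis by (simp add: right_diff_distrib sum_subtractf)
  qed simp
qed

text \<open>The type argument only provides the dimension.\<close>

definition slope_weights :: "'p itself \<Rightarrow> (nat \<Rightarrow> real) \<Rightarrow> bool" where
  "slope_weights _ w \<longleftrightarrow> (\<forall>j\<in>{1..CARD('p)}. 0 \<le> w j \<and> (\<forall>i\<in>{1..j}. w j \<le> w i))"

lemma slope_weightsD:
  assumes "slope_weights TYPE('p) w"
  shows "\<lbrakk>1 \<le> j; j \<le> CARD('p)\<rbrakk> \<Longrightarrow> 0 \<le> w j"
    and "\<lbrakk>1 \<le> i; i \<le> j; j \<le> CARD('p)\<rbrakk> \<Longrightarrow> w j \<le> w i"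
  using assms by (auto simp: slope_weights_def)

lemma slope_weights_sharp: "slope_weights TYPE('p) (sharp (b :: real ^ 'p))"
  by (auto simp: slope_weights_def sharp_nonneg sharp_antimono)

text \<open>Among all ways to pair the weights with the coordinates, sorting is the best one, because
  it maximizes every partial sum. As a maximum of seminorms over the pairings, the sorted norm is
  then subadditive, see \<open>sorted_l1_triangle\<close>.\<close>

lemma sorted_l1_ge_arrangement:
  fixes b :: "real ^ 'p"
  assumes w: "slope_weights TYPE('p) w" and e: "bij_betw e {1..CARD('p)} UNIV"
  shows "(\<Sum>j = 1..CARD('p). w j * \<bar>b $ e j\<bar>) \<le> sorted_l1 w b"
  unfolding sorted_l1_def
proof (rule sum_weighted_mono)
  fix k assume k: "k \<in> {1..CARD('p)}"
  have inj: "inj_on e {1..k}"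
    by (rule inj_on_subset[of e "{1..CARD('p)}"]) (use e k in \<open>auto simp: bij_betw_def\<close>)
  have "(\<Sum>j = 1..k. \<bar>b $ e j\<bar>) = (\<Sum>i\<in>e ` {1..k}. \<bar>b $ i\<bar>)"
    by (rule sum.reindex[OF inj, unfolded comp_def, symmetric])
  also have "\<dots> \<le> (\<Sum>j = 1..k. sharp b j)"
    using sum_le_sum_sharp[of b "e ` {1..k}"] card_image[OF inj] k by simp
  finally show "(\<Sum>j = 1..k. \<bar>b $ e j\<bar>) \<le> (\<Sum>j = 1..k. sharp b j)" .
qed (use w in \<open>auto simp: slope_weights_def\<close>)

lemma sorted_l1_eq_sorts:
  fixes b :: "real ^ 'p"
  assumes "sorts e b"
  shows "sorted_l1 w b = (\<Sum>j = 1..CARD('p). w j * \<bar>b $ e j\<bar>)"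
  unfolding sorted_l1_def by (intro sum.cong) (auto simp: sharp_eq_sorts[OF assms])

lemma rearrangement_inequality:
  fixes g u :: "real ^ 'p"
  shows "g \<bullet> u \<le> (\<Sum>j = 1..CARD('p). sharp g j * sharp u j)"
proof -
  obtain e where e: "sorts e g" by (rule sorts_exists)
  have "g \<bullet> u \<le> (\<Sum>i\<in>UNIV. \<bar>g $ i\<bar> * \<bar>u $ i\<bar>)"
    unfolding inner_vec_def by (auto simp flip: abs_mult intro!: sum_mono)
  also have "\<dots> = (\<Sum>j = 1..CARD('p). \<bar>g $ e j\<bar> * \<bar>u $ e j\<bar>)"
    by (rule sum.reindex_bij_betw[OF sortsD(1)[OF e], symmetric])
  also have "\<dots> = (\<Sum>j = 1..CARD('p). sharp g j * \<bar>u $ e j\<bar>)"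
    by (intro sum.cong) (auto simp: sharp_eq_sorts[OF e])
  also have "\<dots> \<le> sorted_l1 (sharp g) u"
    by (rule sorted_l1_ge_arrangement[OF slope_weights_sharp sortsD(1)[OF e]])
  finally show ?thesis by (simp add: sorted_l1_def)
qed

lemma sorted_l1_nonneg:
  fixes b :: "real ^ 'p"
  assumes "slope_weights TYPE('p) w"
  shows "0 \<le> sorted_l1 w b"
  unfolding sorted_l1_def
  by (intro sum_nonneg mult_nonneg_nonneg slope_weightsD(1)[OF assms] sharp_nonneg) auto

lemma sorted_l1_scaleR: "sorted_l1 w (c *\<^sub>R b) = \<bar>c\<bar> * sorted_l1 w (b :: real ^ 'p)"
proof -
  obtain e where e: "sorts e b" by (rule sorts_exists)
  then have "sorts e (c *\<^sub>R b)"
    by (auto simp: sorts_def abs_mult intro!: mult_left_mono)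
  with e show ?thesis
    by (simp add: sorted_l1_eq_sorts abs_mult sum_distrib_left algebra_simps)
qed

lemma sorted_l1_triangle:
  fixes b :: "real ^ 'p"
  assumes w: "slope_weights TYPE('p) w"
  shows "sorted_l1 w (b + c) \<le> sorted_l1 w b + sorted_l1 w c"
proof -
  obtain e where e: "sorts e (b + c)" by (rule sorts_exists)
  have "sorted_l1 w (b + c) = (\<Sum>j = 1..CARD('p). w j * \<bar>b $ e j + c $ e j\<bar>)"
    by (simp add: sorted_l1_eq_sorts[OF e])
  also have "\<dots> \<le> (\<Sum>j = 1..CARD('p). w j * \<bar>b $ e j\<bar> + w j * \<bar>c $ e j\<bar>)"
    unfolding distrib_left[symmetric]
    by (intro sum_mono mult_left_mono) (auto intro: slope_weightsD(1)[OF w])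
  also have "\<dots> \<le> sorted_l1 w b + sorted_l1 w c"
    unfolding sum.distrib by (intro add_mono sorted_l1_ge_arrangement w sortsD(1)[OF e])
  finally show ?thesis .
qed

lemma continuous_on_sorted_l1:
  assumes w: "slope_weights TYPE('p) w"
  shows "continuous_on UNIV (sorted_l1 w :: real ^ 'p \<Rightarrow> real)"
proof (rule convex_on_continuous)
  show "convex_on UNIV (sorted_l1 w :: real ^ 'p \<Rightarrow> real)"
    using sorted_l1_triangle[OF w] by (auto simp: convex_on_def sorted_l1_scaleR) (metis abs_of_nonneg sorted_l1_scaleR)
qed simp

text \<open>Since weights and sorted components both decrease,
  \<open>k w\<^sub>k u\<^sub>k \<le> |u|\<^sub>*\<close> for the \<open>k\<close>-th largest component \<open>u\<^sub>k\<close>. Multiplying by \<open>w\<^sub>k u\<^sub>k\<close> and summing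
  over \<open>k\<close> gives the square of the claim.\<close>

lemma norm_le_sorted_l1:
  fixes b :: "real ^ 'p"
  assumes w: "slope_weights TYPE('p) w"
    and L: "0 \<le> L" "\<And>k. k \<in> {1..CARD('p)} \<Longrightarrow> L\<^sup>2 \<le> real k * (w k)\<^sup>2"
  shows "L * norm b \<le> sorted_l1 w b"
proof (rule power2_le_imp_le)
  let ?p = "CARD('p)"
  have k: "real k * w k * sharp b k \<le> sorted_l1 w b" if k: "k \<in> {1..?p}" for k
  proof -
    have "real k * w k * sharp b k = (\<Sum>j = 1..k. w k * sharp b k)" by simp
    also have "\<dots> \<le> (\<Sum>j = 1..k. w j * sharp b j)"
      using k by (intro sum_mono mult_mono sharp_antimono slope_weightsD[OF w] sharp_nonneg) auto
    also have "\<dots> \<le> sorted_l1 w b" unfolding sorted_l1_def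
      using k by (intro sum_mono2 mult_nonneg_nonneg slope_weightsD[OF w] sharp_nonneg) auto
    finally show ?thesis .
  qed
  have "(L * norm b)\<^sup>2 = (\<Sum>k = 1..?p. L\<^sup>2 * (sharp b k)\<^sup>2)"
    by (simp add: power_mult_distrib sum_sharp_sq[symmetric] sum_distrib_left)
  also have "\<dots> \<le> (\<Sum>k = 1..?p. (real k * (w k)\<^sup>2) * (sharp b k)\<^sup>2)"
    by (intro sum_mono mult_right_mono L) auto
  also have "\<dots> = (\<Sum>k = 1..?p. (w k * sharp b k) * (real k * w k * sharp b k))"
    by (simp add: power2_eq_square algebra_simps)
  also have "\<dots> \<le> (\<Sum>k = 1..?p. (w k * sharp b k) * sorted_l1 w b)"
    by (intro sum_mono mult_left_mono k mult_nonneg_nonneg slope_weightsD[OF w] sharp_nonneg) auto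
  also have "\<dots> = (sorted_l1 w b)\<^sup>2"
    by (simp add: sorted_l1_def power2_eq_square sum_distrib_right)
  finally show "(L * norm b)\<^sup>2 \<le> (sorted_l1 w b)\<^sup>2" .
qed (rule sorted_l1_nonneg[OF w])

section \<open>Consequences of minimality for Slope\<close>

text \<open>Evaluate the norm of \<open>c\<close> along an enumeration that lists the support of \<open>b\<close> first. On the
  support the triangle inequality loses at most \<open>|u\<^sub>i|\<close>, for \<open>u = c - b\<close>; outside it the components
  of \<open>c\<close> and \<open>u\<close> agree. The enumeration is chosen to sort \<open>b\<close>, which makes the norm of \<open>b\<close> exact,
  and to sort \<open>u\<close> outside the support, which compares the tail with that of the full
  rearrangement of \<open>u\<close>.\<close>

lemma sorted_l1_decrease:
  fixes b c :: "real ^ 'p"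
  assumes w: "slope_weights TYPE('p) w" and s: "l0 b \<le> s" "s \<le> CARD('p)"
  shows "sorted_l1 w b - sorted_l1 w c
    \<le> (\<Sum>j = 1..s. w j * sharp (c - b) j) - (\<Sum>j = s+1..CARD('p). w j * sharp (c - b) j)"
proof -
  let ?p = "CARD('p)"
  define u where "u = c - b"
  define S where "S = {i. b $ i \<noteq> 0}"
  define m where "m = card S"
  have m: "m \<le> s" "m \<le> ?p" using s by (auto simp: m_def S_def l0_def)
  \<comment> \<open>Scaling \<open>u\<close> by a small enough \<open>eps\<close> outside the support \<open>S\<close> forces every enumeration that
    sorts \<open>v\<close> to list \<open>S\<close> first, and keeps the order of \<open>u\<close> outside \<open>S\<close>. The 1 covers empty \<open>S\<close>.\<close>
  define eps where "eps = Min (insert 1 ((\<lambda>i. \<bar>b $ i\<bar>) ` S)) / (norm u + 1)"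
  have eps0: "0 < eps"
    by (auto simp: eps_def S_def intro!: divide_pos_pos add_nonneg_pos)
  have eps: "eps * \<bar>u $ k\<bar> < \<bar>b $ i\<bar>" if "i \<in> S" for i k
  proof -
    have "eps * \<bar>u $ k\<bar> < eps * (norm u + 1)"
      using component_le_norm_cart[of u k] eps0 by (intro mult_strict_left_mono) auto
    also have "\<dots> = Min (insert 1 ((\<lambda>i. \<bar>b $ i\<bar>) ` S))"
      using norm_ge_zero[of u] by (simp add: eps_def add_nonneg_eq_0_iff)
    also have "\<dots> \<le> \<bar>b $ i\<bar>" using that by (intro Min_le) auto
    finally show ?thesis .
  qed
  define v where "v = (\<chi> i. if i \<in> S then b $ i else eps * u $ i)"
  have v: "\<bar>v $ k\<bar> < \<bar>v $ i\<bar>" if "i \<in> S" "k \<notin> S" for i k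
    using that eps eps0 by (auto simp: v_def abs_mult)
  obtain e where e: "sorts e v" by (rule sorts_exists)
  note bij = sortsD(1)[OF e]
  have inj: "inj_on e {1..?p}" and im: "e ` {1..?p} = UNIV" using bij by (auto simp: bij_betw_def)
  have Sm: "e ` {1..m} = S"
  proof -
    define J where "J = {j\<in>{1..?p}. e j \<in> S}"
    have eJ: "e ` J = S"
    proof
      show "S \<subseteq> e ` J"
      proof
        fix i assume "i \<in> S"
        moreover obtain j where "j \<in> {1..?p}" "i = e j" using im by (metis UNIV_I imageE)
        ultimately show "i \<in> e ` J" by (auto simp: J_def)
      qed
    qed (auto simp: J_def)
    have cJ: "card J = m"
      unfolding m_def eJ[symmetric]
      by (rule card_image[symmetric]) (rule inj_on_subset[OF inj], auto simp: J_def)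
    have finJ: "finite J" by (simp add: J_def)
    have down: "i \<in> J" if "j \<in> J" "i \<in> {1..j}" for i j
      using that v[of "e j" "e i"] sortsD(2)[OF e, of i j] by (force simp: J_def)
    have "J = {1..m}"
    proof (rule card_seteq[symmetric])
      show "{1..m} \<subseteq> J"
      proof (rule ccontr)
        assume "\<not> {1..m} \<subseteq> J"
        then obtain i where i: "i \<in> {1..m}" "i \<notin> J" by blast
        then have "J \<subseteq> {1..i-1}"
          using down by (fastforce simp: J_def not_less_eq_eq)
        then have "card J \<le> card {1..i-1}" by (intro card_mono) auto
        with i cJ show False by auto
      qed
    qed (simp_all add: cJ finJ)
    with eJ show ?thesis by simp
  qed
  have outside: "e j \<notin> S" if "j \<in> {m+1..?p}" for j
  proof
    assume "e j \<in> S"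
    then obtain i where "i \<in> {1..m}" "e i = e j" using Sm by (metis imageE)
    with inj_onD[OF inj, of i j] that m show False by auto
  qed
  have inside: "e j \<in> S" if "j \<in> {1..m}" for j using that Sm by blast
  have split: "(\<Sum>j = 1..?p. F j) = (\<Sum>j = 1..m. F j) + (\<Sum>j = m+1..?p. F j)" for F :: "nat \<Rightarrow> real"
    using m by (metis le_add2 sum.ub_add_nat le_add_diff_inverse add.commute)
  have "sorts e b"
    unfolding sorts_def
  proof (intro conjI bij ballI)
    fix j i assume *: "j \<in> {1..?p}" "i \<in> {1..j}"
    show "\<bar>b $ e j\<bar> \<le> \<bar>b $ e i\<bar>"
    proof (cases "e j \<in> S")
      case True
      with * v[of "e j" "e i"] sortsD(2)[OF e, of i j] have "e i \<in> S" by force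
      with True * sortsD(2)[OF e, of i j] show ?thesis by (simp add: v_def)
    qed (simp add: S_def)
  qed
  then have "sorted_l1 w b = (\<Sum>j = 1..?p. w j * \<bar>b $ e j\<bar>)"
    by (rule sorted_l1_eq_sorts)
  also have "\<dots> = (\<Sum>j = 1..m. w j * \<bar>b $ e j\<bar>)"
    unfolding split using outside by (simp add: S_def)
  finally have b: "sorted_l1 w b = (\<Sum>j = 1..m. w j * \<bar>b $ e j\<bar>)" .
  have "sorted_l1 w c \<ge> (\<Sum>j = 1..?p. w j * \<bar>c $ e j\<bar>)"
    by (rule sorted_l1_ge_arrangement[OF w bij])
  moreover have "(\<Sum>j = 1..?p. w j * \<bar>c $ e j\<bar>)
      = (\<Sum>j = 1..m. w j * \<bar>c $ e j\<bar>) + (\<Sum>j = m+1..?p. w j * \<bar>u $ e j\<bar>)"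
    unfolding split using outside by (auto simp: S_def u_def intro!: sum.cong)
  moreover have "(\<Sum>j = 1..m. w j * \<bar>c $ e j\<bar>) \<ge> (\<Sum>j = 1..m. w j * \<bar>b $ e j\<bar> - w j * \<bar>u $ e j\<bar>)"
    unfolding right_diff_distrib[symmetric] using m
    by (intro sum_mono mult_left_mono) (auto simp: u_def intro: slope_weightsD[OF w])
  ultimately have 1: "sorted_l1 w b - sorted_l1 w c
      \<le> (\<Sum>j = 1..m. w j * \<bar>u $ e j\<bar>) - (\<Sum>j = m+1..?p. w j * \<bar>u $ e j\<bar>)"
    unfolding b sum_subtractf by linarith
  have 2: "(\<Sum>j = 1..m. w j * \<bar>u $ e j\<bar>) \<le> (\<Sum>j = 1..m. w j * sharp u j)"
  proof -
    define w' where "w' = (\<lambda>j. if j \<le> m then w j else 0)"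
    have "slope_weights TYPE('p) w'"
      using w by (auto simp: slope_weights_def w'_def)
    from sorted_l1_ge_arrangement[OF this bij, of u] show ?thesis
      unfolding sorted_l1_def split by (simp add: w'_def)
  qed
  \<comment> \<open>A component of \<open>u\<close> that exceeds the one at position \<open>j > m\<close> comes from \<open>S\<close> or precedes it
    outside \<open>S\<close>; either way its position is before \<open>j\<close>.\<close>
  have 3: "(\<Sum>j = m+1..?p. w j * sharp u j) \<le> (\<Sum>j = m+1..?p. w j * \<bar>u $ e j\<bar>)"
  proof (intro sum_mono mult_left_mono sharp_le_if_few_above)
    fix j assume j: "j \<in> {m+1..?p}"
    have "{i. \<bar>u $ e j\<bar> < \<bar>u $ i\<bar>} \<subseteq> e ` {1..j - 1}"
    proof
      fix i assume i: "i \<in> {i. \<bar>u $ e j\<bar> < \<bar>u $ i\<bar>}"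
      obtain k where k: "k \<in> {1..?p}" "i = e k" using im by (metis UNIV_I imageE)
      have "k < j"
      proof (rule ccontr)
        assume "\<not> k < j"
        with j k have "k \<in> {m+1..?p}" by auto
        with \<open>\<not> k < j\<close> j k i sortsD(2)[OF e, of j k] outside[of j] outside[of k] eps0
        show False by (simp add: v_def abs_mult)
      qed
      with k show "i \<in> e ` {1..j - 1}" by auto
    qed
    then have "card {i. \<bar>u $ e j\<bar> < \<bar>u $ i\<bar>} \<le> card (e ` {1..j - 1})" by (intro card_mono) auto
    also have "\<dots> \<le> j - 1" using card_image_le[of "{1..j - 1}" e] by simp
    finally show "card {i. \<bar>u $ e j\<bar> < \<bar>u $ i\<bar>} < j" using j by auto
  qed (auto intro: slope_weightsD[OF w])
  have 4: "(\<Sum>j = 1..m. w j * sharp u j) \<le> (\<Sum>j = 1..s. w j * sharp u j)"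
    using m s by (intro sum_mono2 mult_nonneg_nonneg slope_weightsD[OF w] sharp_nonneg) auto
  have 5: "(\<Sum>j = s+1..?p. w j * sharp u j) \<le> (\<Sum>j = m+1..?p. w j * sharp u j)"
    using m s by (intro sum_mono2 mult_nonneg_nonneg slope_weightsD[OF w] sharp_nonneg) auto
  show ?thesis using 1 2 3 4 5 unfolding u_def by linarith
qed

lemma emp_norm_sq: "(emp_norm (u :: real ^ 'n))\<^sup>2 = (u \<bullet> u) / real CARD('n)"
  by (simp add: emp_norm_def inner_vec_def power2_eq_square sum_nonneg)

lemma emp_norm_eq: "emp_norm (u :: real ^ 'n) = norm u / sqrt (real CARD('n))"
  by (simp add: emp_norm_def norm_vec_def L2_set_def real_sqrt_divide)

lemma emp_norm_nonneg: "0 \<le> emp_norm u"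
  by (simp add: emp_norm_eq)

lemma emp_norm_convex_combination:
  fixes a c :: "real ^ 'n"
  shows "(emp_norm ((1 - t) *\<^sub>R a + t *\<^sub>R c))\<^sup>2
    = (1 - t) * (emp_norm a)\<^sup>2 + t * (emp_norm c)\<^sup>2 - t * (1 - t) * (emp_norm (a - c))\<^sup>2"
proof -
  let ?z = "(1 - t) *\<^sub>R a + t *\<^sub>R c"
  have "?z \<bullet> ?z = (1 - t) * (a \<bullet> a) + t * (c \<bullet> c) - t * (1 - t) * ((a - c) \<bullet> (a - c))"
    by (simp add: inner_add_left inner_add_right inner_diff_left inner_diff_right inner_commute[of c a])
      algebra
  then show ?thesis
    by (simp only: emp_norm_sq add_divide_distrib diff_divide_distrib times_divide_eq_right)
qed

text \<open>Compare the minimizer with a point \<open>(1 - t) b + t c\<close> of the segment towards \<open>c\<close>. The squared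
  norm is strongly convex along \<open>X\<close>, so the objective at that point is below the chord by
  \<open>t (1 - t)\<close> times the squared distance; divide by \<open>t\<close> and let \<open>t\<close> tend to zero.\<close>

lemma slope_minimizer_gap:
  fixes X :: "real ^ 'p ^ 'n"
  assumes w: "slope_weights TYPE('p) w" and b: "is_slope X w y b"
  shows "(emp_norm (X *v b - y))\<^sup>2 + 2 * sorted_l1 w b + (emp_norm (X *v (b - c)))\<^sup>2
    \<le> (emp_norm (X *v c - y))\<^sup>2 + 2 * sorted_l1 w c"
proof -
  define Q where "Q = (\<lambda>b. (emp_norm (X *v b - y))\<^sup>2 + 2 * sorted_l1 w b)"
  define D where "D = (emp_norm (X *v (b - c)))\<^sup>2"
  have min: "Q b \<le> Q z" for z
    using b by (auto simp: is_slope_def is_arg_min_def Q_def not_less)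
  have step: "(1 - t) * D \<le> Q c - Q b" if t: "0 < t" "t < 1" for t
  proof -
    let ?z = "(1 - t) *\<^sub>R b + t *\<^sub>R c"
    have z: "X *v ?z - y = (1 - t) *\<^sub>R (X *v b - y) + t *\<^sub>R (X *v c - y)"
      by (simp add: matrix_vector_right_distrib scaleR_matrix_vector_assoc[symmetric]
          matrix_vector_mult_scaleR algebra_simps)
    have "sorted_l1 w ?z \<le> (1 - t) * sorted_l1 w b + t * sorted_l1 w c"
      using sorted_l1_triangle[OF w, of "(1 - t) *\<^sub>R b" "t *\<^sub>R c"] t by (simp add: sorted_l1_scaleR)
    moreover have "(X *v b - y) - (X *v c - y) = X *v (b - c)"
      by (simp add: matrix_vector_mult_diff_distrib)
    ultimately have "Q ?z \<le> (1 - t) * Q b + t * Q c - t * (1 - t) * D"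
      unfolding Q_def z emp_norm_convex_combination D_def by (simp add: algebra_simps)
    with min[of ?z] have "t * ((1 - t) * D) \<le> t * (Q c - Q b)" by (simp add: algebra_simps)
    then show ?thesis using t by simp
  qed
  have "((\<lambda>t. (1 - t) * D) \<longlongrightarrow> (1 - 0) * D) (at_right 0)"
    by (intro tendsto_intros)
  moreover have "\<forall>\<^sub>F t in at_right 0. (1 - t) * D \<le> Q c - Q b"
    by (rule eventually_mono[OF eventually_at_right_real[of 0 1]]) (auto intro: step)
  ultimately have "D \<le> Q c - Q b"
    using tendsto_upperbound[of "\<lambda>t. (1 - t) * D" "(1 - 0) * D" "at_right 0"]
    by (simp add: trivial_limit_at_right_real)
  then show ?thesis by (simp add: Q_def D_def)
qed

text \<open>Expanding the squares turns the data \<open>f + z\<close> into the signal \<open>f\<close> plus a term linear in \<open>z\<close>.\<close>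

lemma slope_basic_inequality:
  fixes X :: "real ^ 'p ^ 'n"
  assumes w: "slope_weights TYPE('p) w" and b: "is_slope X w (f + z) b"
    and s: "l0 c \<le> s" "s \<le> CARD('p)"
  shows "(emp_norm (X *v b - f))\<^sup>2 + (emp_norm (X *v (b - c)))\<^sup>2
    \<le> (emp_norm (X *v c - f))\<^sup>2 + 2 * (z \<bullet> (X *v (b - c)) / real CARD('n))
       + 2 * (\<Sum>j = 1..s. w j * sharp (b - c) j) - 2 * (\<Sum>j = s+1..CARD('p). w j * sharp (b - c) j)"
proof -
  have "(emp_norm (X *v d - (f + z)))\<^sup>2
      = (emp_norm (X *v d - f))\<^sup>2 - 2 * (z \<bullet> (X *v d - f)) / real CARD('n) + (emp_norm z)\<^sup>2" for d
    unfolding emp_norm_sq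
    by (simp add: inner_simps inner_commute field_simps)
  from this[of b] this[of c]
  have "(emp_norm (X *v b - (f + z)))\<^sup>2 - (emp_norm (X *v c - (f + z)))\<^sup>2
      = (emp_norm (X *v b - f))\<^sup>2 - (emp_norm (X *v c - f))\<^sup>2
        - 2 * (z \<bullet> (X *v (b - c)) / real CARD('n))"
    by (simp add: matrix_vector_mult_diff_distrib inner_simps field_simps)
  with slope_minimizer_gap[OF w b, of c] sorted_l1_decrease[OF w s, of b]
  show ?thesis by linarith
qed

section \<open>The Prekopa-Leindler inequality on the line\<close>

text \<open>Up to the factor two, \<open>C\<close> contains the translate of \<open>A\<close> by an almost
  smallest element of \<open>B\<close> and the translate of \<open>B\<close> by an almost largest element of \<open>A\<close>. These
  translates overlap in an interval of small length at most.\<close>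

lemma brunn_minkowski_midpoint_bounded:
  fixes A B C :: "real set"
  assumes [measurable]: "A \<in> sets borel" "B \<in> sets borel" "C \<in> sets borel"
    and ne: "A \<noteq> {}" "B \<noteq> {}" and bd: "bdd_above A" "bdd_below B"
    and C: "\<And>a b. \<lbrakk>a \<in> A; b \<in> B\<rbrakk> \<Longrightarrow> (a + b) / 2 \<in> C"
  shows "emeasure lborel A + emeasure lborel B \<le> 2 * emeasure lborel C"
proof (rule ennreal_le_epsilon)
  fix r :: real assume r: "0 < r"
  define e where "e = r / 2"
  obtain a where a: "a \<in> A" "Sup A - e < a"
    using less_cSupD[OF ne(1), of "Sup A - e"] r by (auto simp: e_def)
  obtain b where b: "b \<in> B" "b < Inf B + e"
    using cInf_lessD[OF ne(2), of "Inf B + e"] r by (auto simp: e_def)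
  let ?I = "{(a + Inf B) / 2 .. (Sup A + b) / 2}"
  have len: "emeasure lborel ?I \<le> ennreal e"
  proof -
    have "a \<le> Sup A" "Inf B \<le> b" using a b bd by (auto intro: cSup_upper cInf_lower)
    then show ?thesis using a b by (simp add: emeasure_lborel_Icc field_simps)
  qed
  have half: "emeasure lborel S = 2 * (\<integral>\<^sup>+x. indicator S (- c + 2 * x) \<partial>lborel)"
    if [measurable]: "S \<in> sets borel" for S :: "real set" and c
    using nn_integral_real_affine[of "indicator S" 2 "- c"] by simp
  have pt: "indicator A (- b + 2 * x) + indicator B (- a + 2 * x)
      \<le> (indicator C x + indicator ?I x :: ennreal)" for x
  proof -
    have 1: "x \<in> C" if "- b + 2 * x \<in> A" using C[OF that b(1)] by simp
    have 2: "x \<in> C" if "- a + 2 * x \<in> B" using C[OF a(1) that] by simp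
    have 3: "x \<in> ?I" if "- b + 2 * x \<in> A" "- a + 2 * x \<in> B"
      using cSup_upper[OF that(1) bd(1)] cInf_lower[OF that(2) bd(2)] by (simp add: field_simps)
    show ?thesis using 1 2 3 by (auto simp: indicator_def)
  qed
  have "emeasure lborel A + emeasure lborel B
      = 2 * (\<integral>\<^sup>+x. indicator A (- b + 2 * x) + indicator B (- a + 2 * x) \<partial>lborel)"
    by (subst half[of A b], simp, subst half[of B a], simp)
      (simp add: nn_integral_add distrib_left)
  also have "\<dots> \<le> 2 * (\<integral>\<^sup>+x. indicator C x + indicator ?I x \<partial>lborel)"
    by (intro mult_left_mono nn_integral_mono pt) simp
  also have "\<dots> = 2 * emeasure lborel C + 2 * emeasure lborel ?I"
    by (simp add: nn_integral_add distrib_left)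
  also have "\<dots> \<le> 2 * emeasure lborel C + 2 * ennreal e"
    by (intro add_left_mono mult_left_mono len) simp
  also have "2 * ennreal e = ennreal r"
    using r by (simp add: e_def flip: ennreal_numeral ennreal_mult')
  finally show "emeasure lborel A + emeasure lborel B \<le> 2 * emeasure lborel C + ennreal r" .
qed

lemma brunn_minkowski_midpoint:
  fixes A B C :: "real set"
  assumes [measurable]: "A \<in> sets borel" "B \<in> sets borel" "C \<in> sets borel"
    and ne: "A \<noteq> {}" "B \<noteq> {}"
    and C: "\<And>a b. \<lbrakk>a \<in> A; b \<in> B\<rbrakk> \<Longrightarrow> (a + b) / 2 \<in> C"
  shows "emeasure lborel A + emeasure lborel B \<le> 2 * emeasure lborel C"
proof -
  obtain a b where ab: "a \<in> A" "b \<in> B" using ne by blast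
  define cut where "cut = (\<lambda>(S :: real set) n. S \<inter> {- real n..real n})"
  have lim: "(\<lambda>n. emeasure lborel (cut S n)) \<longlonglongrightarrow> emeasure lborel S"
    if [measurable]: "S \<in> sets borel" for S
  proof -
    have "(\<Union>n. cut S n) = S"
    proof (intro equalityI subsetI)
      fix x assume "x \<in> S"
      moreover obtain n where "\<bar>x\<bar> \<le> real n" using real_arch_simple by blast
      ultimately show "x \<in> (\<Union>n. cut S n)" by (auto simp: cut_def intro!: exI[of _ n])
    qed (auto simp: cut_def)
    moreover have "range (cut S) \<subseteq> sets lborel" "incseq (cut S)"
      by (auto simp: cut_def incseq_def)
    ultimately show ?thesis using Lim_emeasure_incseq[of "cut S" lborel] by simp
  qed
  obtain N where N: "\<bar>a\<bar> \<le> real N" "\<bar>b\<bar> \<le> real N"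
    using real_arch_simple[of "max \<bar>a\<bar> \<bar>b\<bar>"] by auto
  have "emeasure lborel (cut A n) + emeasure lborel (cut B n) \<le> 2 * emeasure lborel C"
    if n: "N \<le> n" for n
  proof (rule brunn_minkowski_midpoint_bounded)
    have "a \<in> cut A n" "b \<in> cut B n" using ab N n by (auto simp: cut_def)
    then show "cut A n \<noteq> {}" "cut B n \<noteq> {}" by blast+
    show "bdd_above (cut A n)" "bdd_below (cut B n)"
      by (auto simp: cut_def bdd_above_def bdd_below_def)
  qed (auto simp: cut_def intro: C)
  then show ?thesis
    by (intro LIMSEQ_le_const2[OF tendsto_add[OF lim lim]]) auto
qed

lemma nn_integral_layer_cake:
  fixes f :: "real \<Rightarrow> real"
  assumes [measurable]: "f \<in> borel_measurable borel" and f: "\<And>x. 0 \<le> f x"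
  shows "(\<integral>\<^sup>+x. f x \<partial>lborel) = (\<integral>\<^sup>+t. indicator {0<..} t * emeasure lborel {x. t < f x} \<partial>lborel)"
proof -
  have "(\<integral>\<^sup>+x. f x \<partial>lborel)
      = (\<integral>\<^sup>+x. \<integral>\<^sup>+t. (if 0 < t \<and> t < f x then 1 else 0) \<partial>lborel \<partial>lborel)"
  proof (rule nn_integral_cong)
    fix x
    have "(\<integral>\<^sup>+t. (if 0 < t \<and> t < f x then 1 else 0) \<partial>lborel)
        = (\<integral>\<^sup>+t. indicator {0<..<f x} t \<partial>lborel)"
      by (intro nn_integral_cong) (auto simp: indicator_def)
    then show "ennreal (f x) = (\<integral>\<^sup>+t. (if 0 < t \<and> t < f x then 1 else 0) \<partial>lborel)"
      using f by simp
  qed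
  also have "\<dots> = (\<integral>\<^sup>+t. \<integral>\<^sup>+x. (if 0 < t \<and> t < f x then 1 else 0) \<partial>lborel \<partial>lborel)"
    by (rule lborel_pair.Fubini') measurable
  also have "\<dots> = (\<integral>\<^sup>+t. indicator {0<..} t * emeasure lborel {x. t < f x} \<partial>lborel)"
  proof (rule nn_integral_cong)
    fix t
    have "(\<integral>\<^sup>+x. (if 0 < t \<and> t < f x then 1 else 0) \<partial>lborel)
        = (\<integral>\<^sup>+x. indicator {0<..} t * indicator {x. t < f x} x \<partial>lborel)"
      by (intro nn_integral_cong) (auto simp: indicator_def)
    then show "(\<integral>\<^sup>+x. (if 0 < t \<and> t < f x then 1 else 0) \<partial>lborel)
        = indicator {0<..} t * emeasure lborel {x. t < f x}"
      by (simp add: nn_integral_cmult)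
  qed
  finally show ?thesis .
qed

text \<open>Both \<open>f\<close> and \<open>g\<close> have supremum one, so for \<open>0 < t < 1\<close> their level sets
  \<open>{f > t}\<close> and \<open>{g > t}\<close> are nonempty, and the midpoints of the two sets lie in \<open>{h > t}\<close>. Apply the
  Brunn-Minkowski inequality to each level and integrate over \<open>t\<close>.\<close>

lemma prekopa_leindler_midpoint_normalized:
  fixes f g h :: "real \<Rightarrow> real"
  assumes [measurable]: "f \<in> borel_measurable borel" "g \<in> borel_measurable borel" "h \<in> borel_measurable borel"
    and nn: "\<And>x. 0 \<le> f x" "\<And>x. 0 \<le> g x" "\<And>x. 0 \<le> h x"
    and le1: "\<And>x. f x \<le> 1" "\<And>x. g x \<le> 1"
    and sup: "\<And>t. t < 1 \<Longrightarrow> \<exists>x. t < f x" "\<And>t. t < 1 \<Longrightarrow> \<exists>x. t < g x"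
    and h: "\<And>x y. f x * g y \<le> (h ((x + y) / 2))\<^sup>2"
  shows "(\<integral>\<^sup>+x. f x \<partial>lborel) + (\<integral>\<^sup>+x. g x \<partial>lborel) \<le> 2 * (\<integral>\<^sup>+x. h x \<partial>lborel)"
proof -
  let ?L = "\<lambda>(k :: real \<Rightarrow> real) t. indicator {0<..} t * emeasure lborel {x. t < k x}"
  have [measurable]: "?L k \<in> borel_measurable borel"
    if [measurable]: "k \<in> borel_measurable borel" for k
    by measurable
  have "(\<integral>\<^sup>+x. f x \<partial>lborel) + (\<integral>\<^sup>+x. g x \<partial>lborel) = (\<integral>\<^sup>+t. ?L f t + ?L g t \<partial>lborel)"
    by (simp add: nn_integral_layer_cake nn nn_integral_add)
  also have "\<dots> \<le> (\<integral>\<^sup>+t. 2 * ?L h t \<partial>lborel)"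
  proof (rule nn_integral_mono)
    fix t :: real
    consider "t \<le> 0" | "1 \<le> t" | "0 < t" "t < 1" by linarith
    then show "?L f t + ?L g t \<le> 2 * ?L h t"
    proof cases
      case 2
      then have "{x. t < f x} = {}" "{x. t < g x} = {}" using le1 by (auto simp: not_less intro: order_trans)
      then show ?thesis by simp
    next
      case 3
      have "emeasure lborel {x. t < f x} + emeasure lborel {x. t < g x} \<le> 2 * emeasure lborel {x. t < h x}"
      proof (rule brunn_minkowski_midpoint)
        fix x y assume "x \<in> {x. t < f x}" "y \<in> {x. t < g x}"
        then have "t * t < f x * g y" using 3 by (intro mult_strict_mono) auto
        also have "\<dots> \<le> (h ((x + y) / 2))\<^sup>2" by (rule h)
        finally have "t\<^sup>2 < (h ((x + y) / 2))\<^sup>2" by (simp add: power2_eq_square)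
        then show "(x + y) / 2 \<in> {x. t < h x}" using nn(3) by (auto intro: power_less_imp_less_base)
      qed (use sup 3 in auto)
      then show ?thesis using 3 by simp
    qed simp
  qed
  also have "\<dots> = 2 * (\<integral>\<^sup>+x. h x \<partial>lborel)"
    by (simp add: nn_integral_layer_cake nn nn_integral_cmult)
  finally show ?thesis .
qed

text \<open>The inequality of the arithmetic and the geometric mean.\<close>

lemma ennreal_mult_le_square:
  fixes a b c :: ennreal
  assumes "a + b \<le> 2 * c"
  shows "a * b \<le> c * c"
proof (cases "c = top")
  case True then show ?thesis by (simp add: ennreal_mult_top ennreal_top_mult)
next
  case False
  then obtain c' where c': "c = ennreal c'" "0 \<le> c'" by (cases c) auto
  have "2 * c < top" using c' by (simp add: ennreal_mult_less_top)
  then have "a < top" "b < top" using assms by (auto simp: less_top[symmetric] top_unique)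
  then obtain a' b' where ab: "a = ennreal a'" "0 \<le> a'" "b = ennreal b'" "0 \<le> b'"
    by (cases a; cases b) auto
  have le: "a' + b' \<le> 2 * c'"
    using assms ab c' by (simp flip: ennreal_plus ennreal_numeral ennreal_mult')
  have "a' * b' \<le> ((a' + b') / 2)\<^sup>2"
    using zero_le_power2[of "a' - b'"] by (simp add: power2_eq_square field_simps)
  also have "\<dots> \<le> c'\<^sup>2" using le ab by (intro power_mono) auto
  finally show ?thesis using ab c' by (simp add: power2_eq_square flip: ennreal_mult')
qed

text \<open>Dividing \<open>f\<close> and \<open>g\<close> by their suprema and \<open>h\<close> by the geometric mean of these
  reduces the claim to the normalized case. The suprema are finite because \<open>h\<close> is bounded.\<close>

lemma prekopa_leindler_midpoint:
  fixes f g h :: "real \<Rightarrow> real"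
  assumes [measurable]: "f \<in> borel_measurable borel" "g \<in> borel_measurable borel" "h \<in> borel_measurable borel"
    and nn: "\<And>x. 0 \<le> f x" "\<And>x. 0 \<le> g x" "\<And>x. 0 \<le> h x"
    and bd: "\<And>x. h x \<le> H"
    and h: "\<And>x y. f x * g y \<le> (h ((x + y) / 2))\<^sup>2"
  shows "(\<integral>\<^sup>+x. f x \<partial>lborel) * (\<integral>\<^sup>+x. g x \<partial>lborel) \<le> (\<integral>\<^sup>+x. h x \<partial>lborel)\<^sup>2"
proof (cases "(\<exists>x. f x \<noteq> 0) \<and> (\<exists>x. g x \<noteq> 0)")
  case False
  then have "(\<forall>x. f x = 0) \<or> (\<forall>x. g x = 0)" by auto
  then show ?thesis by auto
next
  case True
  then obtain x0 y0 where pos: "0 < f x0" "0 < g y0" using nn by (metis less_eq_real_def)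
  define F where "F = (SUP x. f x)"
  define G where "G = (SUP x. g x)"
  have H: "f x * g y \<le> H\<^sup>2" for x y
    using h[of x y] power_mono[OF bd[of "(x + y) / 2"] nn(3), of 2] by linarith
  have bdd: "bdd_above (range f)" "bdd_above (range g)"
  proof -
    show "bdd_above (range f)"
      using H[of _ y0] pos by (intro bdd_aboveI2[where M="H\<^sup>2 / g y0"]) (simp add: field_simps)
    show "bdd_above (range g)"
      using H[of x0] pos by (intro bdd_aboveI2[where M="H\<^sup>2 / f x0"]) (simp add: field_simps)
  qed
  have le: "f x \<le> F" "g x \<le> G" for x
    unfolding F_def G_def by (auto intro: cSUP_upper bdd)
  have FG: "0 < F" "0 < G" using le[of x0] le[of y0] pos by auto
  define q where "q = sqrt (F * G)"
  have q: "0 < q" "q * q = F * G" using FG by (auto simp: q_def)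
  have "(\<integral>\<^sup>+x. f x / F \<partial>lborel) + (\<integral>\<^sup>+x. g x / G \<partial>lborel) \<le> 2 * (\<integral>\<^sup>+x. h x / q \<partial>lborel)"
  proof (rule prekopa_leindler_midpoint_normalized)
    fix t :: real assume t: "t < 1"
    have "t * F < F" "t * G < G" using t FG by auto
    then show "\<exists>x. t < f x / F" "\<exists>x. t < g x / G"
      using less_cSUP_iff[OF _ bdd(1), of "t * F"] less_cSUP_iff[OF _ bdd(2), of "t * G"] FG
      by (auto simp: F_def[symmetric] G_def[symmetric] field_simps)
  next
    fix x y
    have "f x / F * (g y / G) = f x * g y / (q * q)" by (simp add: q)
    also have "\<dots> \<le> (h ((x + y) / 2))\<^sup>2 / (q * q)"
      using q(1) by (intro divide_right_mono h) auto
    finally show "f x / F * (g y / G) \<le> (h ((x + y) / 2) / q)\<^sup>2" 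
      by (simp add: power_divide power2_eq_square)
  qed (use nn le FG q in auto)
  from ennreal_mult_le_square[OF this]
  have *: "(\<integral>\<^sup>+x. f x / F \<partial>lborel) * (\<integral>\<^sup>+x. g x / G \<partial>lborel) \<le> (\<integral>\<^sup>+x. h x / q \<partial>lborel) * (\<integral>\<^sup>+x. h x / q \<partial>lborel)" .
  have scale: "(\<integral>\<^sup>+x. k x \<partial>lborel) = ennreal c * (\<integral>\<^sup>+x. k x / c \<partial>lborel)"
    if [measurable]: "k \<in> borel_measurable borel" and "0 < c" "\<And>x. 0 \<le> k x" for k :: "real \<Rightarrow> real" and c
    using that by (subst nn_integral_cmult[symmetric]) (auto intro!: nn_integral_cong simp flip: ennreal_mult')
  have "(\<integral>\<^sup>+x. f x \<partial>lborel) * (\<integral>\<^sup>+x. g x \<partial>lborel)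
      = ennreal (F * G) * ((\<integral>\<^sup>+x. f x / F \<partial>lborel) * (\<integral>\<^sup>+x. g x / G \<partial>lborel))"
    by (subst scale[of f F], simp_all add: FG nn, subst scale[of g G])
      (simp_all add: FG nn ennreal_mult' less_imp_le ac_simps)
  also have "\<dots> \<le> ennreal (F * G) * ((\<integral>\<^sup>+x. h x / q \<partial>lborel) * (\<integral>\<^sup>+x. h x / q \<partial>lborel))"
    by (intro mult_left_mono *) simp
  also have "\<dots> = (\<integral>\<^sup>+x. h x \<partial>lborel)\<^sup>2"
    using scale[of h q] q(1) nn
    by (simp add: q(2)[symmetric] power2_eq_square ennreal_mult' less_imp_le ac_simps)
  finally show ?thesis .
qed

section \<open>Infimum convolution and distances under Gaussian measures\<close>

abbreviation std_gaussian :: "real measure" where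
  "std_gaussian \<equiv> density lborel (\<lambda>x. ennreal (std_normal_density x))"

text \<open>The standard normal density \<open>\<phi>\<close> satisfies
  \<open>\<phi> x * \<phi> y * exp ((x - y)\<^sup>2 / 4) = (\<phi> ((x + y) / 2))\<^sup>2\<close> by the parallelogram law. So the
  Prekopa-Leindler inequality applies to \<open>\<phi> f\<close>, \<open>\<phi> g\<close> and \<open>sqrt c \<phi>\<close>.\<close>

lemma gaussian_inf_convolution_real:
  fixes f g :: "real \<Rightarrow> ennreal"
  assumes [measurable]: "f \<in> borel_measurable borel" "g \<in> borel_measurable borel"
    and c: "0 < c" and fg: "\<And>x y. f x * g y \<le> ennreal (c * exp ((x - y)\<^sup>2 / 4))"
  shows "(\<integral>\<^sup>+x. f x \<partial>std_gaussian) * (\<integral>\<^sup>+y. g y \<partial>std_gaussian) \<le> ennreal c"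
proof (cases "(\<exists>x. f x \<noteq> 0) \<and> (\<exists>x. g x \<noteq> 0)")
  case False
  then have "(\<forall>x. f x = 0) \<or> (\<forall>x. g x = 0)" by auto
  then show ?thesis by auto
next
  case True
  then obtain x0 y0 where nz: "f x0 \<noteq> 0" "g y0 \<noteq> 0" by auto
  have "f x \<noteq> top" for x
    using fg[of x y0] nz by (auto simp: ennreal_top_mult top_unique)
  moreover have "g y \<noteq> top" for y
    using fg[of x0 y] nz by (auto simp: ennreal_mult_top top_unique)
  ultimately have fin: "f x = ennreal (enn2real (f x))" "g x = ennreal (enn2real (g x))" for x
    by (simp_all add: ennreal_enn2real_if)
  let ?d = std_normal_density
  have fg': "enn2real (f x) * enn2real (g y) \<le> c * exp ((x - y)\<^sup>2 / 4)" for x y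
    using fg[of x y] c by (subst (asm) fin(1), subst (asm) fin(2)) (simp flip: ennreal_mult')
  have parallelogram: "?d x * ?d y * exp ((x - y)\<^sup>2 / 4) = (?d ((x + y) / 2))\<^sup>2" for x y :: real
  proof -
    have "- x\<^sup>2 / 2 + - y\<^sup>2 / 2 + (x - y)\<^sup>2 / 4 = - ((x + y) / 2)\<^sup>2 / 2 + - ((x + y) / 2)\<^sup>2 / 2"
      by (simp add: power2_eq_square field_simps)
    then have "exp (- x\<^sup>2 / 2) * exp (- y\<^sup>2 / 2) * exp ((x - y)\<^sup>2 / 4)
        = exp (- ((x + y) / 2)\<^sup>2 / 2) * exp (- ((x + y) / 2)\<^sup>2 / 2)"
      by (simp only: exp_add[symmetric])
    then show ?thesis
      by (simp add: std_normal_density_def power2_eq_square)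
  qed
  have int: "(\<integral>\<^sup>+x. k x \<partial>std_gaussian) = (\<integral>\<^sup>+x. ?d x * enn2real (k x) \<partial>lborel)"
    if [measurable]: "k \<in> borel_measurable borel" and k: "\<And>x. k x = ennreal (enn2real (k x))" for k
    by (subst nn_integral_density) (auto simp: ennreal_mult' k[symmetric])
  have "(\<integral>\<^sup>+x. f x \<partial>std_gaussian) * (\<integral>\<^sup>+y. g y \<partial>std_gaussian)
      \<le> (\<integral>\<^sup>+x. sqrt c * ?d x \<partial>lborel)\<^sup>2"
    unfolding int[OF assms(1) fin(1)] int[OF assms(2) fin(2)]
  proof (rule prekopa_leindler_midpoint)
    fix x y
    have "?d x * enn2real (f x) * (?d y * enn2real (g y)) = ?d x * ?d y * (enn2real (f x) * enn2real (g y))"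
      by simp
    also have "\<dots> \<le> ?d x * ?d y * (c * exp ((x - y)\<^sup>2 / 4))"
      by (intro mult_left_mono fg') simp
    also have "\<dots> = c * (?d ((x + y) / 2))\<^sup>2"
      using parallelogram[of x y] by simp
    finally show "?d x * enn2real (f x) * (?d y * enn2real (g y)) \<le> (sqrt c * ?d ((x + y) / 2))\<^sup>2"
      using c by (simp add: power_mult_distrib)
  next
    fix x :: real
    have "?d x \<le> 1 / sqrt (2 * pi)" by (simp add: std_normal_density_def divide_right_mono)
    then show "sqrt c * ?d x \<le> sqrt c * (1 / sqrt (2 * pi))"
      using c by (intro mult_left_mono) auto
  qed (use c in auto)
  also have "(\<integral>\<^sup>+x. sqrt c * ?d x \<partial>lborel) = ennreal (sqrt c) * (\<integral>\<^sup>+x. ?d x \<partial>lborel)"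
    using c by (simp add: ennreal_mult' nn_integral_cmult)
  also have "(\<integral>\<^sup>+x. ?d x \<partial>lborel) = 1"
    using nn_integral_eq_integral[OF integrable_normal_density[of 1 0]] by simp
  also have "(ennreal (sqrt c) * 1)\<^sup>2 = ennreal c"
    using c by (simp add: power2_eq_square flip: ennreal_mult')
  finally show ?thesis .
qed

text \<open>The exponential factorizes over the coordinates. Integrating out one
  coordinate of \<open>f\<close> and \<open>g\<close>, with the others fixed, leaves two functions that satisfy the same
  hypothesis in one dimension less; the constant \<open>c\<close> takes up the factor of the fixed coordinates.\<close>

lemma gaussian_inf_convolution:
  fixes f g :: "('i \<Rightarrow> real) \<Rightarrow> ennreal"
  assumes "finite I"
    and "f \<in> borel_measurable (PiM I (\<lambda>_. std_gaussian))" "g \<in> borel_measurable (PiM I (\<lambda>_. std_gaussian))"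
    and "0 < c"
    and "\<And>x y. \<lbrakk>x \<in> extensional I; y \<in> extensional I\<rbrakk>
      \<Longrightarrow> f x * g y \<le> ennreal (c * exp ((\<Sum>i\<in>I. (x i - y i)\<^sup>2) / 4))"
  shows "(\<integral>\<^sup>+x. f x \<partial>PiM I (\<lambda>_. std_gaussian)) * (\<integral>\<^sup>+y. g y \<partial>PiM I (\<lambda>_. std_gaussian)) \<le> ennreal c"
proof -
  interpret prob_space std_gaussian by (rule prob_space_normal_density) simp
  interpret product_sigma_finite "\<lambda>_. std_gaussian" ..
  show ?thesis
    using assms
  proof (induction I arbitrary: f g c rule: finite_induct)
    case empty
    then show ?case using empty.prems(4)[of "\<lambda>_. undefined" "\<lambda>_. undefined"]
      by (simp add: PiM_empty nn_integral_count_space_finite)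
  next
    case (insert i I)
    note [measurable] = insert.prems(1,2)
    note [simp] = insert.hyps
    let ?F = "\<lambda>f x. \<integral>\<^sup>+t. f (x(i := t)) \<partial>std_gaussian"
    have "?F f x * ?F g y \<le> ennreal (c * exp ((\<Sum>i\<in>I. (x i - y i)\<^sup>2) / 4))"
      if xy: "x \<in> extensional I" "y \<in> extensional I" for x y
    proof (rule gaussian_inf_convolution_real)
      fix t u
      have eq: "(\<Sum>j\<in>insert i I. ((x(i := t)) j - (y(i := u)) j)\<^sup>2)
          = (t - u)\<^sup>2 + (\<Sum>j\<in>I. (x j - y j)\<^sup>2)"
        using insert.hyps by (auto intro!: sum.cong)
      have "x(i := t) \<in> extensional (insert i I)" "y(i := u) \<in> extensional (insert i I)"
        using xy by (auto simp: extensional_def)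
      then show "f (x(i := t)) * g (y(i := u))
          \<le> ennreal (c * exp ((\<Sum>i\<in>I. (x i - y i)\<^sup>2) / 4) * exp ((t - u)\<^sup>2 / 4))"
        by (intro order_trans[OF insert.prems(4)]) (simp_all only: eq add_divide_distrib exp_add mult_ac order_refl)
    next
      have [measurable]: "(\<lambda>t. z(i := t)) \<in> borel \<rightarrow>\<^sub>M PiM (insert i I) (\<lambda>_. std_gaussian)"
        if "z \<in> extensional I" for z
      proof (rule measurable_fun_upd[where J=I])
        show "(\<lambda>_. z) \<in> borel \<rightarrow>\<^sub>M PiM I (\<lambda>_. std_gaussian)"
          using that by (intro measurable_const) (simp add: space_PiM PiE_iff)
      qed (auto intro: measurable_ident_sets)
      show "(\<lambda>t. f (x(i := t))) \<in> borel_measurable borel" "(\<lambda>t. g (y(i := t))) \<in> borel_measurable borel"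
        using xy by measurable
    qed (use insert.prems(3) in auto)
    moreover have "?F f \<in> borel_measurable (PiM I (\<lambda>_. std_gaussian))"
      "?F g \<in> borel_measurable (PiM I (\<lambda>_. std_gaussian))"
      by measurable
    ultimately show ?case
      by (simp only: product_nn_integral_insert[OF insert.hyps insert.prems(1)]
          product_nn_integral_insert[OF insert.hyps insert.prems(2)] insert.IH insert.prems(3))
  qed
qed

lemma borel_measurable_vec_of_components:
  fixes f :: "'a \<Rightarrow> real ^ 'n"
  assumes "\<And>i. (\<lambda>x. f x $ i) \<in> borel_measurable M"
  shows "f \<in> borel_measurable M"
  unfolding borel_measurable_euclidean_space[of f]
  using assms by (auto simp: Basis_vec_def inner_axis)

lemma gaussian_noise_distr:
  fixes z :: "'a \<Rightarrow> real ^ 'n"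
  assumes "prob_space M" and z: "gaussian_noise M 1 z"
  shows "distr M (PiM UNIV (\<lambda>_. borel)) (\<lambda>\<omega> i. z \<omega> $ i) = PiM UNIV (\<lambda>_. std_gaussian)"
proof -
  interpret prob_space M by fact
  have d: "distributed M lborel (\<lambda>\<omega>. z \<omega> $ i) (\<lambda>x. ennreal (std_normal_density x))" for i
    using z by (simp add: gaussian_noise_def)
  have rv: "random_variable borel (\<lambda>\<omega>. z \<omega> $ i)" for i
    using distributed_measurable[OF d] by simp
  have "distr M borel (\<lambda>\<omega>. z \<omega> $ i) = std_gaussian" for i
    using distributed_distr_eq_density[OF d] by (metis distr_cong sets_lborel)
  then show ?thesis
    using z indep_vars_iff_distr_eq_PiM'[where I=UNIV and M'="\<lambda>_. borel" and X="\<lambda>i \<omega>. z \<omega> $ i"] rv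
    by (simp add: gaussian_noise_def restrict_UNIV)
qed

lemma gaussian_noise_measurable:
  fixes z :: "'a \<Rightarrow> real ^ 'n"
  assumes "gaussian_noise M \<sigma> z"
  shows "z \<in> borel_measurable M"
  using assms distributed_measurable
  by (intro borel_measurable_vec_of_components) (fastforce simp: gaussian_noise_def)

text \<open>Maurey's concentration inequality: apply the infimum-convolution inequality to
  \<open>exp (d(x, K)\<^sup>2 / 4)\<close> and the indicator of \<open>K\<close>, using \<open>d(x, K) \<le> |x - y|\<close> for \<open>y \<in> K\<close>.\<close>

lemma gaussian_distance_to_set:
  fixes z :: "'a \<Rightarrow> real ^ 'n"
  assumes M: "prob_space M" and z: "gaussian_noise M 1 z" and K: "closed K"
  shows "(\<integral>\<^sup>+\<omega>. exp ((infdist (z \<omega>) K)\<^sup>2 / 4) \<partial>M) * emeasure M {\<omega>\<in>space M. z \<omega> \<in> K} \<le> 1"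
proof -
  let ?P = "PiM UNIV (\<lambda>_. std_gaussian) :: ('n \<Rightarrow> real) measure"
  let ?V = "\<lambda>x :: 'n \<Rightarrow> real. \<chi> i. x i"
  have [measurable]: "z \<in> borel_measurable M" using z by (rule gaussian_noise_measurable)
  have [measurable]: "K \<in> sets borel" using K by simp
  have [measurable]: "(\<lambda>\<omega> i. z \<omega> $ i) \<in> M \<rightarrow>\<^sub>M PiM UNIV (\<lambda>_. borel)"
    by (rule measurable_PiM_single')
      (auto intro!: measurable_compose[of z M borel "\<lambda>v. v $ _"] borel_measurable_continuous_onI continuous_intros)
  have sets: "sets ?P = sets (PiM UNIV (\<lambda>_. borel))" by (intro sets_PiM_cong) auto
  have [measurable]: "?V \<in> borel_measurable (PiM UNIV (\<lambda>_. borel))"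
    by (rule borel_measurable_vec_of_components) simp
  have [measurable]: "(\<lambda>x. infdist (?V x) K) \<in> borel_measurable (PiM UNIV (\<lambda>_. borel))"
    by (rule measurable_compose[of ?V _ borel]) (auto intro!: borel_measurable_continuous_onI continuous_intros)
  let ?f = "\<lambda>x. ennreal (exp ((infdist (?V x) K)\<^sup>2 / 4))" and ?g = "\<lambda>x. indicator K (?V x) :: ennreal"
  have "(\<integral>\<^sup>+x. ?f x \<partial>?P) * (\<integral>\<^sup>+x. ?g x \<partial>?P) \<le> ennreal 1"
  proof (rule gaussian_inf_convolution)
    show "?f \<in> borel_measurable ?P" "?g \<in> borel_measurable ?P"
      unfolding measurable_cong_sets[OF sets refl] by measurable
    show "?f x * ?g y \<le> ennreal (1 * exp ((\<Sum>i\<in>UNIV. (x i - y i)\<^sup>2) / 4))" for x y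
    proof (cases "?V y \<in> K")
      case True
      have "(infdist (?V x) K)\<^sup>2 \<le> (dist (?V x) (?V y))\<^sup>2"
        using infdist_le[OF True] by (intro power_mono) (auto simp: infdist_nonneg)
      also have "\<dots> = (\<Sum>i\<in>UNIV. (x i - y i)\<^sup>2)"
        by (simp add: dist_vec_def L2_set_def sum_nonneg dist_real_def)
      finally show ?thesis using True by simp
    qed simp
  qed simp_all
  also have "(\<integral>\<^sup>+x. ?f x \<partial>?P) = (\<integral>\<^sup>+\<omega>. exp ((infdist (z \<omega>) K)\<^sup>2 / 4) \<partial>M)"
    unfolding gaussian_noise_distr[OF M z, symmetric] by (subst nn_integral_distr) (auto simp: vec_nth_inverse)
  also have "(\<integral>\<^sup>+x. ?g x \<partial>?P) = (\<integral>\<^sup>+\<omega>. indicator K (z \<omega>) \<partial>M)"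
    unfolding gaussian_noise_distr[OF M z, symmetric]
    by (subst nn_integral_distr) (auto simp: vec_nth_inverse)
  also have "\<dots> = (\<integral>\<^sup>+\<omega>. indicator {\<omega>\<in>space M. z \<omega> \<in> K} \<omega> \<partial>M)"
    by (rule nn_integral_cong) (simp add: indicator_def)
  also have "\<dots> = emeasure M {\<omega>\<in>space M. z \<omega> \<in> K}"
    by (rule nn_integral_indicator) measurable
  finally show ?thesis by simp
qed

section \<open>Order statistics of correlated Gaussian variables\<close>

text \<open>With the factor \<open>exp (3 x\<^sup>2 / 8)\<close> the standard normal density becomes twice the
  normal density of standard deviation two.\<close>

lemma nn_integral_exp_square_std_normal:
  "(\<integral>\<^sup>+x. ennreal (std_normal_density x) * ennreal (exp (3 / 8 * x\<^sup>2)) \<partial>lborel) = 2"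
proof -
  have "std_normal_density x * exp (3 / 8 * x\<^sup>2) = 2 * normal_density 0 2 x" for x :: real
  proof -
    have "sqrt (2 * pi * 2\<^sup>2) = sqrt (2 * pi) * sqrt (2\<^sup>2)" by (rule real_sqrt_mult)
    moreover have "exp (- x\<^sup>2 / 2) * exp (3 / 8 * x\<^sup>2) = exp (- x\<^sup>2 / (2 * 2\<^sup>2))"
      unfolding exp_add[symmetric] by (simp add: field_simps)
    ultimately show ?thesis unfolding std_normal_density_def normal_density_def by simp
  qed
  then have "(\<integral>\<^sup>+x. ennreal (std_normal_density x) * ennreal (exp (3 / 8 * x\<^sup>2)) \<partial>lborel)
      = (\<integral>\<^sup>+x. ennreal 2 * ennreal (normal_density 0 2 x) \<partial>lborel)"
    by (intro nn_integral_cong) (simp flip: ennreal_mult', simp add: ennreal_mult')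
  also have "\<dots> = 2 * (\<integral>\<^sup>+x. ennreal (normal_density 0 2 x) \<partial>lborel)"
    by (simp add: nn_integral_cmult)
  also have "(\<integral>\<^sup>+x. ennreal (normal_density 0 2 x) \<partial>lborel) = 1"
    using nn_integral_eq_integral[OF integrable_normal_density[of 2 0]] by simp
  finally show ?thesis by simp
qed

lemma gaussian_noise_inner:
  fixes z :: "'a \<Rightarrow> real ^ 'n"
  assumes "prob_space M" and z: "gaussian_noise M 1 z" and c: "norm c = 1"
  shows "distributed M lborel (\<lambda>\<omega>. c \<bullet> z \<omega>) std_normal_density"
proof -
  interpret prob_space M by fact
  define I where "I = {i. c $ i \<noteq> 0}"
  have "I \<noteq> {}"
    using c by (auto simp: I_def) (metis norm_zero vec_eq_iff zero_index zero_neq_one)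
  have "indep_vars (\<lambda>_. borel) (\<lambda>i \<omega>. c $ i * z \<omega> $ i) I"
    using z indep_vars_compose2[of "\<lambda>_. borel" "\<lambda>i \<omega>. z \<omega> $ i" I "\<lambda>i x. c $ i * x" "\<lambda>_. borel"]
    by (auto simp: gaussian_noise_def intro: indep_vars_subset)
  moreover have "distributed M lborel (\<lambda>\<omega>. c $ i * z \<omega> $ i) (normal_density 0 \<bar>c $ i\<bar>)" if "i \<in> I" for i
    using normal_density_affine[of "\<lambda>\<omega>. z \<omega> $ i" 0 1 "c $ i" 0] z that
    by (simp add: gaussian_noise_def I_def)
  ultimately have "distributed M lborel (\<lambda>\<omega>. \<Sum>i\<in>I. c $ i * z \<omega> $ i)
      (normal_density (\<Sum>i\<in>I. 0) (sqrt (\<Sum>i\<in>I. \<bar>c $ i\<bar>\<^sup>2)))"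
    using \<open>I \<noteq> {}\<close> by (intro sum_indep_normal) (auto simp: I_def)
  moreover have "(\<Sum>i\<in>I. c $ i * z \<omega> $ i) = c \<bullet> z \<omega>" for \<omega>
    unfolding inner_vec_def by (rule sum.mono_neutral_cong_left) (auto simp: I_def)
  moreover have "sqrt (\<Sum>i\<in>I. \<bar>c $ i\<bar>\<^sup>2) = norm c"
    unfolding norm_vec_def L2_set_def
    by (rule arg_cong[of _ _ sqrt], rule sum.mono_neutral_cong_left) (auto simp: I_def)
  ultimately show ?thesis using c by simp
qed

lemma gaussian_noise_exp_square:
  fixes z :: "'a \<Rightarrow> real ^ 'n"
  assumes M: "prob_space M" and z: "gaussian_noise M 1 z" and c: "norm c \<le> 1"
  shows "(\<integral>\<^sup>+\<omega>. exp (3 / 8 * (c \<bullet> z \<omega>)\<^sup>2) \<partial>M) \<le> 2"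
proof (cases "c = 0")
  case True
  then show ?thesis using prob_space.emeasure_space_1[OF M] by simp
next
  case False
  define d where "d = c /\<^sub>R norm c"
  have d: "norm d = 1" "c = norm c *\<^sub>R d" using False by (auto simp: d_def)
  have "(c \<bullet> z \<omega>)\<^sup>2 \<le> (d \<bullet> z \<omega>)\<^sup>2" for \<omega>
  proof -
    have "(c \<bullet> z \<omega>)\<^sup>2 = (norm c)\<^sup>2 * (d \<bullet> z \<omega>)\<^sup>2"
      by (subst d(2)) (simp add: power_mult_distrib)
    also have "\<dots> \<le> 1 * (d \<bullet> z \<omega>)\<^sup>2"
      using c by (intro mult_right_mono) (auto simp: power_le_one)
    finally show ?thesis by simp
  qed
  then have "(\<integral>\<^sup>+\<omega>. exp (3 / 8 * (c \<bullet> z \<omega>)\<^sup>2) \<partial>M) \<le> (\<integral>\<^sup>+\<omega>. exp (3 / 8 * (d \<bullet> z \<omega>)\<^sup>2) \<partial>M)"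
    by (intro nn_integral_mono) (auto intro!: ennreal_leI)
  also have "\<dots> = (\<integral>\<^sup>+x. ennreal (std_normal_density x) * ennreal (exp (3 / 8 * x\<^sup>2)) \<partial>lborel)"
    using gaussian_noise_inner[OF M z d(1)] by (subst distributed_nn_integral) auto
  also have "\<dots> = 2" by (rule nn_integral_exp_square_std_normal)
  finally show ?thesis .
qed

text \<open>The Slope weights of the theorem are these times \<open>A \<sigma> / sqrt n\<close>. The type argument only
  provides the number \<open>p\<close> of covariates.\<close>

definition order_weight :: "'p itself \<Rightarrow> nat \<Rightarrow> real" where
  "order_weight _ j = sqrt (ln (2 * real CARD('p) / real j))"

lemma ln_ratio_ge:
  assumes "1 \<le> j" "j \<le> CARD('p::finite)"
  shows "ln 2 \<le> ln (2 * real CARD('p) / real j)"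
proof -
  have "2 \<le> 2 * real CARD('p) / real j" using assms by (simp add: field_simps)
  then show ?thesis by simp
qed

text \<open>The \<open>j\<close> largest components alone contribute at least
  \<open>j exp (3 (sharp g j)\<^sup>2 / 8)\<close> to the sum, whence
  \<open>(sharp g j)\<^sup>2 \<le> 8/3 (5 ln 2 + ln (2p/j))\<close>. The right-hand side is at most \<open>16 ln (2p/j)\<close>
  because \<open>2p/j \<ge> 2\<close>. The value 64 is chosen to produce exactly the constant 4.\<close>

lemma sharp_le_if_exp_sum:
  fixes g :: "real ^ 'p"
  assumes S: "(\<Sum>i\<in>UNIV. exp (3 / 8 * (g $ i)\<^sup>2)) \<le> 64 * real CARD('p)"
    and j: "1 \<le> j" "j \<le> CARD('p)"
  shows "sharp g j \<le> 4 * order_weight TYPE('p) j"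
proof -
  let ?p = "real CARD('p)"
  have "real j * exp (3 / 8 * (sharp g j)\<^sup>2) = (\<Sum>k = 1..j. exp (3 / 8 * (sharp g j)\<^sup>2))" by simp
  also have "\<dots> \<le> (\<Sum>k = 1..j. exp (3 / 8 * (sharp g k)\<^sup>2))"
    using j by (intro sum_mono) (auto intro!: power_mono sharp_antimono sharp_nonneg)
  also have "\<dots> \<le> (\<Sum>k = 1..CARD('p). exp (3 / 8 * (sharp g k)\<^sup>2))"
    using j by (intro sum_mono2) auto
  also have "\<dots> \<le> 64 * ?p"
    using S sum_sharp[of "\<lambda>x. exp (3 / 8 * x\<^sup>2)" g] by simp
  finally have "exp (3 / 8 * (sharp g j)\<^sup>2) \<le> 2 ^ 5 * (2 * ?p / real j)"
    using j by (simp add: field_simps)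
  then have "3 / 8 * (sharp g j)\<^sup>2 \<le> ln (2 ^ 5 * (2 * ?p / real j))"
    using j by (subst ln_ge_iff) auto
  also have "\<dots> = 5 * ln 2 + ln (2 * ?p / real j)"
    using j ln_realpow[of "2::real" 5] by (subst ln_mult) auto
  also have "\<dots> \<le> 6 * ln (2 * ?p / real j)"
    using ln_ratio_ge[OF j] by simp
  finally have *: "(sharp g j)\<^sup>2 \<le> 16 * ln (2 * ?p / real j)" by linarith
  have nn: "0 \<le> ln (2 * ?p / real j)"
    using ln_ratio_ge[OF j] ln_gt_zero[of "2::real"] by linarith
  show ?thesis
  proof (rule power2_le_imp_le)
    show "(sharp g j)\<^sup>2 \<le> (4 * order_weight TYPE('p) j)\<^sup>2"
      unfolding order_weight_def power_mult_distrib real_sqrt_pow2[OF nn] using * by simp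
    show "0 \<le> 4 * order_weight TYPE('p) j"
      unfolding order_weight_def using nn by (simp only: real_sqrt_ge_zero mult_nonneg_nonneg zero_le_numeral)
  qed
qed

lemma slope_weights_order_weight: "slope_weights TYPE('p::finite) (order_weight TYPE('p))"
  unfolding slope_weights_def
proof (intro ballI conjI)
  fix j i assume j: "j \<in> {1..CARD('p)}"
  then show "0 \<le> order_weight TYPE('p) j"
    using ln_ratio_ge[of j, where 'p='p] ln_gt_zero[of "2::real"] by (simp add: order_weight_def)
  assume i: "i \<in> {1..j}"
  then show "order_weight TYPE('p) j \<le> order_weight TYPE('p) i"
    using j unfolding order_weight_def real_sqrt_le_iff
    by (subst ln_le_cancel_iff) (auto simp: field_simps)
qed

text \<open>Noise vectors, in units of \<open>\<sigma>\<close>, whose correlation with the design is controlled by the sorted norm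
  for all directions at once. As an intersection of half-spaces the set is closed, so that the distance to
  it is attained.\<close>

definition tame_noise :: "real ^ 'p ^ 'n \<Rightarrow> (real ^ 'n) set" where
  "tame_noise X = {z. \<forall>u. z \<bullet> (X *v u) \<le> 4 * sqrt (real CARD('n)) * sorted_l1 (order_weight TYPE('p)) u}"

lemma closed_tame_noise: "closed (tame_noise X)"
  unfolding tame_noise_def by (intro closed_Collect_all closed_Collect_le continuous_intros)

lemma zero_in_tame_noise: "0 \<in> tame_noise (X :: real ^ 'p ^ 'n)"
  using sorted_l1_nonneg[OF slope_weights_order_weight[where 'p='p]] by (auto simp: tame_noise_def)

text \<open>Each variable \<open>z \<bullet> X e\<^sub>j / sqrt n\<close> is Gaussian with variance at most one, however the
  columns are correlated, so the exponential sum of \<open>sharp_le_if_exp_sum\<close> has mean at most \<open>2p\<close>. By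
  Markov's inequality it exceeds \<open>64p\<close> with probability at most \<open>1/32\<close>.\<close>

lemma prob_tame_noise:
  fixes z :: "'a \<Rightarrow> real ^ 'n" and X :: "real ^ 'p ^ 'n"
  assumes M: "prob_space M" and z: "gaussian_noise M 1 z" and X: "\<And>j. emp_norm (X *v axis j 1) \<le> 1"
  shows "31 / 32 \<le> measure M {\<omega>\<in>space M. z \<omega> \<in> tame_noise X}"
proof -
  interpret prob_space M by fact
  let ?p = "real CARD('p)" and ?n = "real CARD('n)"
  have [measurable]: "z \<in> borel_measurable M" using z by (rule gaussian_noise_measurable)
  have [measurable]: "tame_noise X \<in> sets borel" by (simp add: closed_tame_noise)
  \<comment> \<open>The normalized columns of \<open>X\<close> and the vector \<open>g v\<close> of their correlations with \<open>v\<close>.\<close>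
  define c where "c = (\<lambda>j. (X *v axis j 1) /\<^sub>R sqrt ?n)"
  have c: "norm (c j) \<le> 1" for j using X[of j] by (simp add: c_def emp_norm_eq field_simps)
  define g where "g = (\<lambda>v. \<chi> j. c j \<bullet> v)"
  have inner_g: "v \<bullet> (X *v u) = sqrt ?n * (g v \<bullet> u)" for u v
  proof -
    have "X *v u = X *v (\<Sum>j\<in>UNIV. (u $ j) *\<^sub>R axis j 1)"
      by (subst basis_expansion[of u, unfolded scalar_mult_eq_scaleR, symmetric]) simp
    also have "\<dots> = (\<Sum>j\<in>UNIV. (u $ j) *\<^sub>R (X *v axis j 1))"
      by (simp add: linear_sum[OF matrix_vector_mul_linear] matrix_vector_mult_scaleR)
    finally have "v \<bullet> (X *v u) = (\<Sum>j\<in>UNIV. (u $ j) * (v \<bullet> (X *v axis j 1)))"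
      by (simp add: inner_sum_right)
    also have "\<dots> = sqrt ?n * (\<Sum>j\<in>UNIV. (c j \<bullet> v) * (u $ j))"
      unfolding sum_distrib_left by (rule sum.cong) (simp_all add: c_def inner_commute field_simps)
    also have "(\<Sum>j\<in>UNIV. (c j \<bullet> v) * (u $ j)) = g v \<bullet> u"
      unfolding inner_vec_def[of "g v" u] by (simp add: g_def)
    finally show ?thesis .
  qed
  define S where "S = (\<lambda>v. \<Sum>j\<in>UNIV. exp (3 / 8 * (c j \<bullet> v)\<^sup>2))"
  have tame: "v \<in> tame_noise X" if "S v \<le> 64 * ?p" for v
    unfolding tame_noise_def
  proof (intro CollectI allI)
    fix u
    have "g v \<bullet> u \<le> (\<Sum>j = 1..CARD('p). sharp (g v) j * sharp u j)"
      by (rule rearrangement_inequality)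
    also have "\<dots> \<le> (\<Sum>j = 1..CARD('p). 4 * order_weight TYPE('p) j * sharp u j)"
      using that by (intro sum_mono mult_right_mono sharp_le_if_exp_sum) (auto simp: S_def g_def sharp_nonneg)
    finally have "g v \<bullet> u \<le> 4 * sorted_l1 (order_weight TYPE('p)) u"
      by (simp add: sorted_l1_def sum_distrib_left mult_ac)
    then show "v \<bullet> (X *v u) \<le> 4 * sqrt ?n * sorted_l1 (order_weight TYPE('p)) u"
      unfolding inner_g by (simp add: mult_left_mono mult_ac)
  qed
  have [measurable]: "S \<in> borel_measurable borel" unfolding S_def by measurable
  have "(\<integral>\<^sup>+\<omega>. S (z \<omega>) \<partial>M) = (\<Sum>j\<in>UNIV. \<integral>\<^sup>+\<omega>. exp (3 / 8 * (c j \<bullet> z \<omega>)\<^sup>2) \<partial>M)"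
    unfolding S_def by (subst nn_integral_sum[symmetric]) (auto intro!: nn_integral_cong simp: sum_ennreal)
  also have "\<dots> \<le> (\<Sum>j\<in>(UNIV :: 'p set). 2)"
    by (intro sum_mono gaussian_noise_exp_square[OF M z c])
  finally have ES: "(\<integral>\<^sup>+\<omega>. S (z \<omega>) \<partial>M) \<le> ennreal (2 * ?p)"
    by (simp add: mult.commute ennreal_mult'' ennreal_of_nat_eq_real_of_nat)
  have sub: "{\<omega>\<in>space M. z \<omega> \<notin> tame_noise X}
      \<subseteq> {\<omega>\<in>space M. 1 \<le> ennreal (1 / (64 * ?p)) * ennreal (S (z \<omega>))}"
    using tame by (force simp: not_le field_simps simp flip: ennreal_mult' ennreal_1)
  have "emeasure M {\<omega>\<in>space M. z \<omega> \<notin> tame_noise X}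
      \<le> emeasure M {\<omega>\<in>space M. 1 \<le> ennreal (1 / (64 * ?p)) * ennreal (S (z \<omega>))}"
    by (intro emeasure_mono sub) measurable
  also have "\<dots> \<le> ennreal (1 / (64 * ?p)) * (\<integral>\<^sup>+\<omega>. S (z \<omega>) \<partial>M)"
    using nn_integral_Markov_inequality[of "\<lambda>\<omega>. ennreal (S (z \<omega>))" "space M" M "ennreal (1 / (64 * ?p))"]
    by (simp cong: nn_integral_cong)
  also have "\<dots> \<le> ennreal (1 / (64 * ?p)) * ennreal (2 * ?p)"
    by (intro mult_left_mono ES) simp
  also have "\<dots> = ennreal (1 / 32)" by (simp flip: ennreal_mult')
  finally have "measure M {\<omega>\<in>space M. z \<omega> \<notin> tame_noise X} \<le> 1 / 32"
    by (simp add: emeasure_eq_measure)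
  then show ?thesis
    using prob_neg[of "\<lambda>\<omega>. z \<omega> \<in> tame_noise X"] by simp
qed

text \<open>Maurey's inequality bounds the mean of \<open>exp (T / 2)\<close> by \<open>32/31\<close>; the moments follow from
  \<open>x \<le> exp x - 1\<close> and \<open>x\<^sup>2 / 2 \<le> exp x - 1\<close> for \<open>x \<ge> 0\<close>.\<close>

lemma tame_noise_distance_moments:
  fixes z :: "'a \<Rightarrow> real ^ 'n" and X :: "real ^ 'p ^ 'n"
  assumes M: "prob_space M" and z: "gaussian_noise M 1 z" and X: "\<And>j. emp_norm (X *v axis j 1) \<le> 1"
  defines "T \<equiv> \<lambda>\<omega>. (infdist (z \<omega>) (tame_noise X))\<^sup>2 / 2"
  shows "integrable M T" "(\<integral>\<omega>. T \<omega> \<partial>M) \<le> 1 / 2"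
    and "integrable M (\<lambda>\<omega>. (T \<omega>)\<^sup>2)" "(\<integral>\<omega>. (T \<omega>)\<^sup>2 \<partial>M) \<le> 1"
proof -
  interpret prob_space M by fact
  have [measurable]: "z \<in> borel_measurable M" using z by (rule gaussian_noise_measurable)
  have [measurable]: "(\<lambda>x. infdist x (tame_noise X)) \<in> borel_measurable borel"
    by (intro borel_measurable_continuous_onI continuous_intros)
  have Tm [measurable]: "T \<in> borel_measurable M" unfolding T_def by measurable
  have T0: "0 \<le> T \<omega>" for \<omega> by (simp add: T_def)
  define E where "E = (\<integral>\<^sup>+\<omega>. ennreal (exp (T \<omega> / 2)) \<partial>M)"
  define P where "P = measure M {\<omega>\<in>space M. z \<omega> \<in> tame_noise X}"
  have P: "31 / 32 \<le> P" unfolding P_def by (rule prob_tame_noise[OF M z X])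
  have "E * ennreal P \<le> 1"
    using gaussian_distance_to_set[OF M z closed_tame_noise[of X]]
    by (simp add: E_def P_def T_def emeasure_eq_measure)
  moreover have "E * ennreal (31 / 32) \<le> E * ennreal P"
    using P by (intro mult_left_mono ennreal_leI) auto
  ultimately have *: "E * ennreal (31 / 32) \<le> 1" by (rule order_trans[rotated])
  then have "E \<noteq> top" by (auto simp: ennreal_top_mult top_unique)
  then obtain e where e: "E = ennreal e" "0 \<le> e" by (cases E) auto
  have "e \<le> 32 / 31" using * e by (simp flip: ennreal_mult' ennreal_1)
  have intE: "integrable M (\<lambda>\<omega>. exp (T \<omega> / 2))"
    using e by (intro integrableI_nonneg) (auto simp: E_def)
  have "(\<integral>\<omega>. exp (T \<omega> / 2) \<partial>M) \<le> 32 / 31"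
    using \<open>e \<le> 32 / 31\<close> e by (simp add: integral_eq_nn_integral E_def[symmetric])
  then have excess: "(\<integral>\<omega>. exp (T \<omega> / 2) - 1 \<partial>M) \<le> 1 / 31"
    using intE by (simp add: prob_space)
  have b1: "T \<omega> \<le> 2 * (exp (T \<omega> / 2) - 1)" for \<omega>
  proof -
    define y where "y = exp (T \<omega> / 2)"
    have "1 + T \<omega> / 2 \<le> y" unfolding y_def by (rule exp_ge_add_one_self)
    then show ?thesis unfolding y_def[symmetric] by simp
  qed
  have b2: "(T \<omega>)\<^sup>2 \<le> 8 * (exp (T \<omega> / 2) - 1)" for \<omega>
    using exp_lower_Taylor_quadratic[of "T \<omega> / 2"] T0[of \<omega>] by (simp add: power_divide)
  have int8: "integrable M (\<lambda>\<omega>. k * (exp (T \<omega> / 2) - 1))" for k :: real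
    using intE by simp
  show I1: "integrable M T"
    by (rule Bochner_Integration.integrable_bound[OF int8[of 2]]) (use T0 b1 in auto)
  show I2: "integrable M (\<lambda>\<omega>. (T \<omega>)\<^sup>2)"
    by (rule Bochner_Integration.integrable_bound[OF int8[of 8]]) (use b2 T0 in auto)
  have "(\<integral>\<omega>. T \<omega> \<partial>M) \<le> 2 * (\<integral>\<omega>. exp (T \<omega> / 2) - 1 \<partial>M)"
    unfolding integral_mult_right_zero[symmetric]
    by (intro integral_mono I1 int8 b1)
  then show "(\<integral>\<omega>. T \<omega> \<partial>M) \<le> 1 / 2" using excess by simp
  have "(\<integral>\<omega>. (T \<omega>)\<^sup>2 \<partial>M) \<le> 8 * (\<integral>\<omega>. exp (T \<omega> / 2) - 1 \<partial>M)"
    unfolding integral_mult_right_zero[symmetric]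
    by (intro integral_mono I2 int8 b2)
  then show "(\<integral>\<omega>. (T \<omega>)\<^sup>2 \<partial>M) \<le> 1" using excess by simp
qed

section \<open>Oracle inequalities for a fixed noise vector\<close>

text \<open>Here \<open>P\<close> and \<open>Q\<close> stand for the contributions of the \<open>s\<close> largest and of the
  remaining components of the error to its sorted norm, \<open>r\<close> for its Euclidean norm, \<open>V\<close> for its
  prediction norm and \<open>h\<close> for the noise term. In both cases of the hypothesis on \<open>h\<close> the left-hand
  side is at most \<open>7/2 x V - V\<^sup>2\<close>, with \<open>x\<close> equal to \<open>L / \<theta>\<close> or \<open>L q\<close>, or it is nonpositive.\<close>

lemma prediction_error_arithmetic:
  fixes P Q V r L q h \<theta> :: real
  assumes nn: "0 \<le> P" "0 \<le> Q" "0 \<le> V" "0 \<le> r" "0 \<le> L" "0 \<le> q" and \<theta>: "0 < \<theta>"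
    and noise: "h \<le> (P + Q) / 2 \<or> h \<le> L * q * V / 2 \<and> r \<le> q * V"
    and P: "P \<le> L * r"
    and cone: "P + Q \<le> 8 * (L * r) \<Longrightarrow> \<theta> * r \<le> V"
  shows "2 * h + 2 * P - 2 * Q + (P + Q) / 2 - V\<^sup>2 \<le> 49 / 16 * L\<^sup>2 * (1 / \<theta>\<^sup>2 + q\<^sup>2)"
proof -
  have complete_square: "7 / 2 * x * V - V\<^sup>2 \<le> 49 / 16 * x\<^sup>2" for x
    using zero_le_power2[of "V - 7 / 4 * x"] by (simp add: power2_eq_square algebra_simps)
  have rhs: "49 / 16 * (L / \<theta>)\<^sup>2 \<le> 49 / 16 * L\<^sup>2 * (1 / \<theta>\<^sup>2 + q\<^sup>2)"
    "49 / 16 * (L * q)\<^sup>2 \<le> 49 / 16 * L\<^sup>2 * (1 / \<theta>\<^sup>2 + q\<^sup>2)"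
    by (simp_all add: power_divide power_mult_distrib distrib_left)
  from noise show ?thesis
  proof
    assume h: "h \<le> (P + Q) / 2"
    show ?thesis
    proof (cases "Q \<le> 7 * P")
      case True
      then have "P + Q \<le> 8 * (L * r)" using P by linarith
      then have "r \<le> V / \<theta>" using cone \<theta> by (simp add: field_simps)
      then have "P \<le> L / \<theta> * V" using P mult_left_mono[of r "V / \<theta>" L] nn by simp
      then have "7 / 2 * P \<le> 7 / 2 * (L / \<theta>) * V" by simp
      moreover have "2 * h + 2 * P - 2 * Q + (P + Q) / 2 \<le> 7 / 2 * P" using h nn by argo
      ultimately have "2 * h + 2 * P - 2 * Q + (P + Q) / 2 - V\<^sup>2 \<le> 7 / 2 * (L / \<theta>) * V - V\<^sup>2"
        by (meson diff_right_mono order_trans)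
      with complete_square[of "L / \<theta>"] rhs(1) show ?thesis by linarith
    next
      case False
      then have "2 * h + 2 * P - 2 * Q + (P + Q) / 2 - V\<^sup>2 \<le> 0"
        using h nn zero_le_power2[of V] by argo
      also have "0 \<le> 49 / 16 * L\<^sup>2 * (1 / \<theta>\<^sup>2 + q\<^sup>2)" by simp
      finally show ?thesis .
    qed
  next
    assume h: "h \<le> L * q * V / 2 \<and> r \<le> q * V"
    then have "P \<le> L * q * V" using P mult_left_mono[of r "q * V" L] nn by simp
    then have "2 * h + 2 * P - 2 * Q + (P + Q) / 2 - V\<^sup>2 \<le> 7 / 2 * (L * q) * V - V\<^sup>2"
      using h nn by argo
    with complete_square[of "L * q"] rhs(2) show ?thesis by linarith
  qed
qed

text \<open>The letters have the same meaning. Unless \<open>r = 0\<close>, both cases give \<open>r \<le> x V\<close> and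
  \<open>V\<^sup>2 \<le> 3/2 L x V\<close>, with \<open>x\<close> equal to \<open>1 / \<theta>\<close> or \<open>q\<close>, so that \<open>V \<le> 3/2 L x\<close> and
  \<open>r \<le> 3/2 L x\<^sup>2\<close>.\<close>

lemma estimation_error_arithmetic:
  fixes P Q V r L q h \<theta> :: real
  assumes nn: "0 \<le> P" "0 \<le> Q" "0 \<le> V" "0 \<le> r" "0 \<le> L" "0 \<le> q"
    and noise: "h \<le> (P + Q) / 2 \<or> h \<le> L * q * V / 2 \<and> r \<le> q * V"
    and V: "V\<^sup>2 \<le> h + P - Q"
    and P: "P \<le> L * r"
    and cone: "\<lbrakk>P + Q \<le> 4 * (L * r); r \<noteq> 0\<rbrakk> \<Longrightarrow> 0 < \<theta> \<and> \<theta> * r \<le> V"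
  shows "r\<^sup>2 \<le> 9 / 4 * L\<^sup>2 * (1 / \<theta> ^ 4 + (q\<^sup>2)\<^sup>2)"
proof -
  have key: "r\<^sup>2 \<le> 9 / 4 * L\<^sup>2 * (x\<^sup>2)\<^sup>2" if x: "0 \<le> x" "V\<^sup>2 \<le> 3 / 2 * (L * x * V)" "r \<le> x * V" for x
  proof -
    have "V \<le> 3 / 2 * L * x"
    proof (cases "V = 0")
      case False
      with x(2) nn show ?thesis by (simp add: power2_eq_square)
    qed (use nn x in simp)
    then have "r \<le> x * (3 / 2 * L * x)" using x mult_left_mono[of V _ x] by fastforce
    then have "r\<^sup>2 \<le> (x * (3 / 2 * L * x))\<^sup>2" using nn by (intro power_mono)
    then show ?thesis by (simp add: power2_eq_square mult_ac)
  qed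
  from noise consider "r = 0" | "r \<noteq> 0" "h \<le> (P + Q) / 2" | "h \<le> L * q * V / 2" "r \<le> q * V" by blast
  then show ?thesis
  proof cases
    case 1
    then show ?thesis by simp
  next
    case 2
    have "Q \<le> 3 * P" using 2 V zero_le_power2[of V] by argo
    then have "P + Q \<le> 4 * (L * r)" using P by linarith
    then have \<theta>: "0 < \<theta>" "r \<le> 1 / \<theta> * V" using cone 2 by (auto simp: field_simps)
    have "P \<le> L * (1 / \<theta>) * V" using P mult_left_mono[OF \<theta>(2), of L] nn by simp
    then have "V\<^sup>2 \<le> 3 / 2 * (L * (1 / \<theta>) * V)" using 2 V nn by argo
    from key[OF _ this] \<theta> have "r\<^sup>2 \<le> 9 / 4 * L\<^sup>2 * ((1 / \<theta>)\<^sup>2)\<^sup>2" by simp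
    also have "((1 / \<theta>)\<^sup>2)\<^sup>2 = 1 / \<theta> ^ 4" by (simp add: power_divide)
    also have "9 / 4 * L\<^sup>2 * (1 / \<theta> ^ 4) \<le> 9 / 4 * L\<^sup>2 * (1 / \<theta> ^ 4 + (q\<^sup>2)\<^sup>2)"
      by (intro mult_left_mono) auto
    finally show ?thesis .
  next
    case 3
    have "P \<le> L * q * V" using P mult_left_mono[OF 3(2), of L] nn by simp
    then have "V\<^sup>2 \<le> 3 / 2 * (L * q * V)" using 3 V nn by argo
    from key[OF _ this 3(2)] nn have "r\<^sup>2 \<le> 9 / 4 * L\<^sup>2 * (q\<^sup>2)\<^sup>2" by simp
    also have "\<dots> \<le> 9 / 4 * L\<^sup>2 * (1 / \<theta> ^ 4 + (q\<^sup>2)\<^sup>2)"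
      by (intro mult_left_mono) auto
    finally show ?thesis .
  qed
qed

lemma ln_twice_card_pos: "0 < ln (2 * real CARD('p::finite))"
proof -
  have "0 < CARD('p)" by simp
  then have "1 < 2 * real CARD('p)" by linarith
  then show ?thesis by simp
qed

text \<open>The condition \<open>ln (2p) \<le> k ln (2p/k)\<close> of \<open>norm_le_sorted_l1\<close> says \<open>2p \<le> x\<^sup>k\<close> for
  \<open>x = 2p/k\<close>, that is \<open>k \<le> x\<^sup>k\<^sup>-\<^sup>1\<close>; this holds because \<open>x \<ge> 2\<close>.\<close>

lemma norm_le_sorted_l1_order_weight:
  fixes u :: "real ^ 'p"
  shows "sqrt (ln (2 * real CARD('p))) * norm u \<le> sorted_l1 (order_weight TYPE('p)) u"
proof (rule norm_le_sorted_l1[OF slope_weights_order_weight])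
  let ?p = "real CARD('p)"
  show "0 \<le> sqrt (ln (2 * ?p))" using ln_twice_card_pos[where 'p='p] by simp
  fix k assume k: "k \<in> {1..CARD('p)}"
  define x where "x = 2 * ?p / real k"
  have x2: "2 \<le> x" using k by (simp add: x_def field_simps)
  have "k \<le> 2 ^ (k - 1)" using k less_exp[of "k - 1"] by linarith
  then have "real k \<le> 2 ^ (k - 1)" by (metis of_nat_le_iff of_nat_numeral of_nat_power)
  also have "\<dots> \<le> x ^ (k - 1)" using x2 by (intro power_mono) auto
  finally have "real k * x \<le> x ^ (k - 1) * x" using x2 by (intro mult_right_mono) auto
  also have "\<dots> = x ^ k" using k by (metis atLeastAtMost_iff power_minus_mult zero_less_one less_le_trans)
  finally have "ln (2 * ?p) \<le> ln (x ^ k)"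
    using k x2 by (subst ln_le_cancel_iff) (auto simp: x_def)
  also have "\<dots> = real k * ln x" using x2 by (simp add: ln_realpow)
  finally have *: "ln (2 * ?p) \<le> real k * ln x" .
  have "0 \<le> ln (2 * ?p)" "0 \<le> ln x" using x2 ln_twice_card_pos[where 'p='p] by simp_all
  then show "(sqrt (ln (2 * ?p)))\<^sup>2 \<le> real k * (order_weight TYPE('p) k)\<^sup>2"
    using * by (simp add: order_weight_def x_def[symmetric])
qed

text \<open>Split \<open>z\<close> into the nearest tame vector and a remainder of norm \<open>sqrt 2 sqrt T\<close>. The noise
  term is then at most \<open>\<sigma> / sqrt n (4 N + sqrt 2 sqrt T V)\<close> with \<open>V\<close> the prediction norm, and the
  constant \<open>4 + sqrt 2\<close> comes from replacing \<open>N\<close> and \<open>sqrt T V\<close> by the larger of the two. If \<open>N\<close> is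
  the smaller one, the comparison of \<open>N\<close> with the Euclidean norm also bounds \<open>u\<close>.\<close>

lemma noise_dichotomy:
  fixes X :: "real ^ 'p ^ 'n" and z :: "real ^ 'n" and u :: "real ^ 'p"
  assumes \<sigma>: "0 < \<sigma>" and A: "2 * (4 + sqrt 2) \<le> A"
  defines "\<kappa> \<equiv> A * \<sigma> / sqrt (real CARD('n))"
    and "T \<equiv> (infdist z (tame_noise X))\<^sup>2 / 2"
    and "\<Lambda> \<equiv> ln (2 * real CARD('p))"
    and "N \<equiv> sorted_l1 (order_weight TYPE('p)) u"
  shows "(\<sigma> *\<^sub>R z) \<bullet> (X *v u) / real CARD('n) \<le> \<kappa> * N / 2
    \<or> (\<sigma> *\<^sub>R z) \<bullet> (X *v u) / real CARD('n) \<le> \<kappa> * sqrt \<Lambda> * sqrt (T / \<Lambda>) * emp_norm (X *v u) / 2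
      \<and> norm u \<le> sqrt (T / \<Lambda>) * emp_norm (X *v u)"
proof -
  let ?n = "real CARD('n)"
  define V where "V = emp_norm (X *v u)"
  define h where "h = (\<sigma> *\<^sub>R z) \<bullet> (X *v u) / ?n"
  have n: "0 < ?n" "sqrt ?n * sqrt ?n = ?n" by auto
  have \<Lambda>: "0 < \<Lambda>" unfolding \<Lambda>_def by (rule ln_twice_card_pos)
  have V: "norm (X *v u) = sqrt ?n * V" "0 \<le> V" by (simp_all add: V_def emp_norm_eq)
  have N: "0 \<le> N" unfolding N_def by (rule sorted_l1_nonneg[OF slope_weights_order_weight])
  have T: "0 \<le> T" "infdist z (tame_noise X) = sqrt 2 * sqrt T"
    by (auto simp: T_def infdist_nonneg simp flip: real_sqrt_mult)
  obtain k where k: "k \<in> tame_noise X" "infdist z (tame_noise X) = dist z k"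
    using infdist_attains_inf[OF closed_tame_noise[of X], of z] zero_in_tame_noise[of X] by blast
  have "z \<bullet> (X *v u) = k \<bullet> (X *v u) + (z - k) \<bullet> (X *v u)" by (simp add: inner_diff_left)
  also have "\<dots> \<le> 4 * sqrt ?n * N + norm (z - k) * norm (X *v u)"
    using k(1) norm_cauchy_schwarz[of "z - k" "X *v u"] by (auto simp: tame_noise_def N_def intro!: add_mono)
  also have "\<dots> = sqrt ?n * (4 * N + sqrt 2 * (sqrt T * V))"
    using k(2) T V by (simp add: dist_norm algebra_simps)
  finally have "\<sigma> * (z \<bullet> (X *v u)) / ?n \<le> \<sigma> * (sqrt ?n * (4 * N + sqrt 2 * (sqrt T * V))) / ?n"
    using \<sigma> by (intro divide_right_mono mult_left_mono) auto
  also have "\<dots> = \<sigma> * (4 * N + sqrt 2 * (sqrt T * V)) * (sqrt ?n / ?n)" by simp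
  also have "sqrt ?n / ?n = 1 / sqrt ?n" using n by (simp add: frac_eq_eq)
  also have "\<sigma> * (4 * N + sqrt 2 * (sqrt T * V)) * (1 / sqrt ?n) = \<sigma> / sqrt ?n * (4 * N + sqrt 2 * (sqrt T * V))"
    by simp
  finally have h: "h \<le> \<sigma> / sqrt ?n * (4 * N + sqrt 2 * (sqrt T * V))" by (simp add: h_def)
  have absorb: "h \<le> \<kappa> * b / 2" if "N \<le> b" "sqrt T * V \<le> b" "0 \<le> b" for b
  proof -
    have "4 * N + sqrt 2 * (sqrt T * V) \<le> 4 * b + sqrt 2 * b"
      using that by (intro add_mono mult_left_mono) auto
    also have "\<dots> = (4 + sqrt 2) * b" by (simp add: algebra_simps)
    also have "\<dots> \<le> A / 2 * b" using A that by (intro mult_right_mono) auto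
    finally have "\<sigma> / sqrt ?n * (4 * N + sqrt 2 * (sqrt T * V)) \<le> \<sigma> / sqrt ?n * (A / 2 * b)"
      using \<sigma> by (intro mult_left_mono) auto
    with h show ?thesis by (simp add: \<kappa>_def mult_ac)
  qed
  show ?thesis
  proof (cases "sqrt T * V \<le> N")
    case True
    then show ?thesis using absorb[of N] N by (simp add: h_def)
  next
    case False
    have q: "sqrt \<Lambda> * sqrt (T / \<Lambda>) = sqrt T" using \<Lambda> by (simp flip: real_sqrt_mult)
    have "h \<le> \<kappa> * (sqrt T * V) / 2" using False absorb[of "sqrt T * V"] V T by auto
    also have "\<dots> = \<kappa> * sqrt \<Lambda> * sqrt (T / \<Lambda>) * V / 2" by (simp add: q[symmetric] mult_ac)
    finally have 1: "h \<le> \<kappa> * sqrt \<Lambda> * sqrt (T / \<Lambda>) * V / 2" .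
    have "sqrt \<Lambda> * norm u \<le> sqrt \<Lambda> * (sqrt (T / \<Lambda>) * V)"
      using False norm_le_sorted_l1_order_weight[of u] q
      by (simp add: \<Lambda>_def[symmetric] N_def[symmetric] mult.assoc[symmetric])
    then have "norm u \<le> sqrt (T / \<Lambda>) * V" using \<Lambda> by simp
    with 1 show ?thesis by (simp add: h_def V_def)
  qed
qed

lemma theta_le:
  assumes "u \<in> C_WRE w s c0"
  shows "theta X w s c0 * norm u \<le> emp_norm (X *v u)"
proof (cases "u = 0")
  case False
  have "bdd_below ((\<lambda>d. emp_norm (X *v d) / norm d) ` (C_WRE w s c0 - {0}))"
    by (intro bdd_belowI2[where m=0]) (auto simp: emp_norm_nonneg)
  then have "theta X w s c0 \<le> emp_norm (X *v u) / norm u"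
    unfolding theta_def using assms False by (intro cINF_lower) auto
  then show ?thesis using False by (simp add: field_simps)
qed (simp add: emp_norm_nonneg)

lemma theta_antimono:
  fixes X :: "real ^ 'p ^ 'n" and u :: "real ^ 'p"
  assumes u: "u \<in> C_WRE w s c0" "u \<noteq> 0" and c: "c0 \<le> c1"
  shows "theta X w s c1 \<le> theta X w s c0"
  unfolding theta_def
proof (rule cINF_superset_mono)
  show "C_WRE w s c0 - {0} \<noteq> ({} :: (real ^ 'p) set)" using u by blast
  show "bdd_below ((\<lambda>d. emp_norm (X *v d) / norm d) ` (C_WRE w s c1 - {0}))"
    by (intro bdd_belowI2[where m=0]) (auto simp: emp_norm_nonneg)
  have "C_WRE w s c0 \<subseteq> (C_WRE w s c1 :: (real ^ 'p) set)"
  proof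
    fix d :: "real ^ 'p" assume "d \<in> C_WRE w s c0"
    then have "sorted_l1 w d \<le> (1 + c0) * norm d * sqrt (\<Sum>j = 1..s. (w j)\<^sup>2)" by (simp add: C_WRE_def)
    also have "\<dots> \<le> (1 + c1) * norm d * sqrt (\<Sum>j = 1..s. (w j)\<^sup>2)"
      using c by (intro mult_right_mono) (auto simp: sum_nonneg)
    finally show "d \<in> C_WRE w s c1" by (simp add: C_WRE_def)
  qed
  then show "C_WRE w s c0 - {0} \<subseteq> (C_WRE w s c1 - {0} :: (real ^ 'p) set)" by blast
qed simp

lemma head_le_norm:
  fixes u :: "real ^ 'p"
  assumes "s \<le> CARD('p)"
  shows "(\<Sum>j = 1..s. w j * sharp u j) \<le> sqrt (\<Sum>j = 1..s. (w j)\<^sup>2) * norm u"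
proof (rule power2_le_imp_le)
  have "(\<Sum>j = 1..s. w j * sharp u j)\<^sup>2 \<le> (\<Sum>j = 1..s. (w j)\<^sup>2) * (\<Sum>j = 1..s. (sharp u j)\<^sup>2)"
    by (rule Cauchy_Schwarz_ineq_sum)
  also have "\<dots> \<le> (\<Sum>j = 1..s. (w j)\<^sup>2) * (norm u)\<^sup>2"
    unfolding sum_sharp_sq[symmetric] using assms
    by (intro mult_left_mono sum_mono2 sum_nonneg) auto
  also have "\<dots> = (sqrt (\<Sum>j = 1..s. (w j)\<^sup>2) * norm u)\<^sup>2"
    by (simp add: power_mult_distrib sum_nonneg)
  finally show "(\<Sum>j = 1..s. w j * sharp u j)\<^sup>2 \<le> (sqrt (\<Sum>j = 1..s. (w j)\<^sup>2) * norm u)\<^sup>2" .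
qed (simp add: sum_nonneg)

text \<open>Deterministic in the noise \<open>\<sigma> z\<close>, with the quality of \<open>z\<close> measured by \<open>T\<close>. The cone with
  parameter 7 appears because half of the sorted norm is kept on the left and half of it absorbs the noise;
  for the estimation error only the noise is absorbed, which leads to the parameter 3.\<close>

lemma slope_pathwise_bounds:
  fixes X :: "real ^ 'p ^ 'n" and f z :: "real ^ 'n" and b c :: "real ^ 'p"
  assumes \<sigma>: "0 < \<sigma>" and A: "2 * (4 + sqrt 2) \<le> A"
    and lam: "\<And>j. j \<in> {1..CARD('p)} \<Longrightarrow> lam j = A * \<sigma> / sqrt (real CARD('n)) * order_weight TYPE('p) j"
    and s: "1 \<le> s" "s \<le> CARD('p)" and \<theta>: "0 < theta X lam s 7"
    and b: "is_slope X lam (f + \<sigma> *\<^sub>R z) b" and c: "l0 c \<le> s"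
  defines "T \<equiv> (infdist z (tame_noise X))\<^sup>2 / 2"
    and "\<Lambda> \<equiv> ln (2 * real CARD('p))"
  shows "1 / 2 * sorted_l1 lam (b - c) + (emp_norm (X *v b - f))\<^sup>2
      \<le> (emp_norm (X *v c - f))\<^sup>2
        + 49 / 16 * (\<Sum>j = 1..s. (lam j)\<^sup>2) * (1 / (theta X lam s 7)\<^sup>2 + T / \<Lambda>)"
    and "f = X *v c \<Longrightarrow> (norm (b - c))\<^sup>2
      \<le> 9 / 4 * (\<Sum>j = 1..s. (lam j)\<^sup>2) * (1 / theta X lam s 3 ^ 4 + (T / \<Lambda>)\<^sup>2)"
proof -
  let ?p = "CARD('p)"
  define \<kappa> where "\<kappa> = A * \<sigma> / sqrt (real CARD('n))"
  define u where "u = b - c"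
  define V where "V = emp_norm (X *v u)"
  define L where "L = sqrt (\<Sum>j = 1..s. (lam j)\<^sup>2)"
  define P where "P = (\<Sum>j = 1..s. lam j * sharp u j)"
  define Q where "Q = (\<Sum>j = s+1..?p. lam j * sharp u j)"
  define q where "q = sqrt (T / \<Lambda>)"
  define h where "h = (\<sigma> *\<^sub>R z) \<bullet> (X *v u) / real CARD('n)"
  have \<Lambda>: "0 < \<Lambda>" unfolding \<Lambda>_def by (rule ln_twice_card_pos)
  have T: "0 \<le> T" by (simp add: T_def)
  have q: "0 \<le> q" "q\<^sup>2 = T / \<Lambda>" using T \<Lambda> by (simp_all add: q_def)
  have V: "0 \<le> V" by (simp add: V_def emp_norm_nonneg)
  have "0 \<le> A" using A by (rule order_trans[rotated]) (simp add: add_nonneg_nonneg)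
  then have \<kappa>: "0 \<le> \<kappa>" using \<sigma> by (simp add: \<kappa>_def)
  have w: "slope_weights TYPE('p) lam"
    using slope_weights_order_weight[where 'p='p] \<kappa> lam
    by (auto simp: slope_weights_def \<kappa>_def[symmetric] intro!: mult_left_mono)

  have norm_scale: "sorted_l1 lam u = \<kappa> * sorted_l1 (order_weight TYPE('p)) u"
    using lam by (simp add: sorted_l1_def sum_distrib_left \<kappa>_def mult.assoc)
  have PQ: "sorted_l1 lam u = P + Q"
    unfolding sorted_l1_def P_def Q_def using s
    using sum.ub_add_nat[of 1 s "\<lambda>j. lam j * sharp u j" "?p - s"] by simp
  have nn: "0 \<le> P" "0 \<le> Q"
    using s unfolding P_def Q_def
    by (auto intro!: sum_nonneg mult_nonneg_nonneg slope_weightsD[OF w] sharp_nonneg)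
  have L: "0 \<le> L" "L\<^sup>2 = (\<Sum>j = 1..s. (lam j)\<^sup>2)" by (simp_all add: L_def sum_nonneg)
  have head: "P \<le> L * norm u" unfolding P_def L_def by (rule head_le_norm[OF s(2)])
  have lam1: "\<kappa> * sqrt \<Lambda> \<le> L"
  proof -
    have "lam 1 = \<kappa> * sqrt \<Lambda>" using lam[of 1] s by (simp add: \<kappa>_def order_weight_def \<Lambda>_def)
    moreover have "(lam 1)\<^sup>2 \<le> (\<Sum>j = 1..s. (lam j)\<^sup>2)"
      using s by (intro member_le_sum) auto
    ultimately show ?thesis unfolding L_def by (intro real_le_rsqrt) simp
  qed
  have noise: "h \<le> (P + Q) / 2 \<or> h \<le> L * q * V / 2 \<and> norm u \<le> q * V"
  proof -
    have "\<kappa> * sqrt \<Lambda> * q * V / 2 \<le> L * q * V / 2"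
      using lam1 q V by (intro divide_right_mono mult_right_mono) auto
    moreover have "h \<le> \<kappa> * sorted_l1 (order_weight TYPE('p)) u / 2
        \<or> h \<le> \<kappa> * sqrt \<Lambda> * q * V / 2 \<and> norm u \<le> q * V"
      unfolding h_def \<kappa>_def \<Lambda>_def q_def V_def T_def by (rule noise_dichotomy[OF \<sigma> A])
    ultimately show ?thesis
      unfolding PQ[symmetric] norm_scale by (meson order_trans)
  qed
  have cone: "\<theta>' * norm u \<le> V" if "P + Q \<le> (1 + c0) * norm u * L" "\<theta>' = theta X lam s c0" for c0 \<theta>'
    using that theta_le[of u lam s c0 X] by (simp add: C_WRE_def PQ L_def V_def)
  have basic: "(emp_norm (X *v b - f))\<^sup>2 + V\<^sup>2 \<le> (emp_norm (X *v c - f))\<^sup>2 + 2 * h + 2 * P - 2 * Q"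
    using slope_basic_inequality[OF w b c s(2)] by (simp add: u_def V_def h_def P_def Q_def)
  have "2 * h + 2 * P - 2 * Q + (P + Q) / 2 - V\<^sup>2
      \<le> 49 / 16 * L\<^sup>2 * (1 / (theta X lam s 7)\<^sup>2 + q\<^sup>2)"
  proof (rule prediction_error_arithmetic[OF nn V norm_ge_zero L(1) q(1) \<theta> noise head])
    assume "P + Q \<le> 8 * (L * norm u)"
    then show "theta X lam s 7 * norm u \<le> V" by (intro cone[of 7]) (simp_all add: mult_ac)
  qed
  with basic show "1 / 2 * sorted_l1 lam (b - c) + (emp_norm (X *v b - f))\<^sup>2
      \<le> (emp_norm (X *v c - f))\<^sup>2
        + 49 / 16 * (\<Sum>j = 1..s. (lam j)\<^sup>2) * (1 / (theta X lam s 7)\<^sup>2 + T / \<Lambda>)"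
    unfolding L(2) q(2) u_def[symmetric] PQ by linarith
  show "(norm (b - c))\<^sup>2 \<le> 9 / 4 * (\<Sum>j = 1..s. (lam j)\<^sup>2) * (1 / theta X lam s 3 ^ 4 + (T / \<Lambda>)\<^sup>2)"
    if f: "f = X *v c"
  proof -
    have "X *v b - f = X *v u" by (simp add: f u_def matrix_vector_mult_diff_distrib)
    then have "V\<^sup>2 \<le> h + P - Q" using basic f by (simp add: V_def emp_norm_eq)
    then have "(norm u)\<^sup>2 \<le> 9 / 4 * L\<^sup>2 * (1 / theta X lam s 3 ^ 4 + (q\<^sup>2)\<^sup>2)"
    proof (rule estimation_error_arithmetic[OF nn V norm_ge_zero L(1) q(1) noise _ head])
      assume le: "P + Q \<le> 4 * (L * norm u)" and u: "norm u \<noteq> 0"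
      then have "u \<in> C_WRE lam s 3" by (simp add: C_WRE_def PQ L_def mult_ac)
      with u have "theta X lam s 7 \<le> theta X lam s 3" by (intro theta_antimono) auto
      with \<theta> le show "0 < theta X lam s 3 \<and> theta X lam s 3 * norm u \<le> V"
        by (intro conjI cone[of 3]) (simp_all add: mult_ac)
    qed
    then show ?thesis unfolding L(2) q(2) u_def .
  qed
qed

section \<open>Bounds in expectation\<close>

lemma gaussian_noise_standardize:
  fixes x :: "'a \<Rightarrow> real ^ 'n"
  assumes "prob_space M" "0 < \<sigma>" and x: "gaussian_noise M \<sigma> x"
  shows "gaussian_noise M 1 (\<lambda>\<omega>. x \<omega> /\<^sub>R \<sigma>)"
proof -
  interpret prob_space M by fact
  have "indep_vars (\<lambda>_. borel) (\<lambda>i \<omega>. inverse \<sigma> * x \<omega> $ i) UNIV"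
    using x indep_vars_compose2[of "\<lambda>_. borel" "\<lambda>i \<omega>. x \<omega> $ i" UNIV "\<lambda>i t. inverse \<sigma> * t" "\<lambda>_. borel"]
    by (auto simp: gaussian_noise_def)
  moreover have "distributed M lborel (\<lambda>\<omega>. inverse \<sigma> * x \<omega> $ i) std_normal_density" for i
    using normal_density_affine[of "\<lambda>\<omega>. x \<omega> $ i" 0 \<sigma> "inverse \<sigma>" 0] x \<open>0 < \<sigma>\<close>
    by (simp add: gaussian_noise_def)
  ultimately show ?thesis by (simp add: gaussian_noise_def)
qed

lemma (in prob_space) expectation_le_by_affine_bound:
  fixes F Y :: "'a \<Rightarrow> real"
  assumes [measurable]: "F \<in> borel_measurable M" and F: "\<And>\<omega>. \<omega> \<in> space M \<Longrightarrow> 0 \<le> F \<omega>"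
    and bound: "\<And>\<omega>. \<omega> \<in> space M \<Longrightarrow> F \<omega> \<le> a + k * (t + Y \<omega> / d)"
    and Y: "integrable M Y" "expectation Y \<le> y" and k: "0 \<le> k" and d: "0 < d"
  shows "integrable M F \<and> expectation F \<le> a + k * (t + y / d)"
proof
  have int: "integrable M (\<lambda>\<omega>. a + k * (t + Y \<omega> / d))" using Y by simp
  show I: "integrable M F"
    by (rule Bochner_Integration.integrable_bound[OF int]) (use F bound in \<open>fastforce+\<close>)
  have "expectation F \<le> expectation (\<lambda>\<omega>. a + k * (t + Y \<omega> / d))"
    by (rule integral_mono[OF I int bound])
  also have "\<dots> = a + k * (t + expectation Y / d)" using Y by (simp add: prob_space)
  also have "\<dots> \<le> a + k * (t + y / d)"
    using Y k d by (intro add_left_mono mult_left_mono divide_right_mono) auto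
  finally show "expectation F \<le> a + k * (t + y / d)" .
qed

theorem corollary6p3:
  fixes M :: "'a measure" and X :: "real ^ 'p ^ 'n" and f :: "real ^ 'n"
    and \<xi> :: "'a \<Rightarrow> real ^ 'n" and bhat :: "'a \<Rightarrow> real ^ 'p"
    and lam :: "nat \<Rightarrow> real" and \<sigma> A :: real and s :: nat
  assumes "prob_space M"
    and "\<sigma> > 0"
    and "gaussian_noise M \<sigma> \<xi>"
    and "s \<in> {1..CARD('p)}"
    and "A \<ge> 2 * (4 + sqrt 2)"
    and "\<forall>j\<in>{1..CARD('p)}.
           lam j = A * \<sigma> * sqrt (ln (2 * real CARD('p) / real j) / real CARD('n))"
    and "WRE X lam s 7"
    and "bhat \<in> borel_measurable M"
    and "\<forall>\<omega>\<in>space M. is_slope X lam (f + \<xi> \<omega>) (bhat \<omega>)"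
  shows "(\<forall>\<beta>. l0 \<beta> \<le> s \<longrightarrow>
            integrable M (\<lambda>\<omega>. 1 / 2 * sorted_l1 lam (bhat \<omega> - \<beta>)
                                + (emp_norm (X *v bhat \<omega> - f))\<^sup>2) \<and>
            (\<integral>\<omega>. 1 / 2 * sorted_l1 lam (bhat \<omega> - \<beta>) + (emp_norm (X *v bhat \<omega> - f))\<^sup>2 \<partial>M)
              \<le> (emp_norm (X *v \<beta> - f))\<^sup>2
                + 49 * (\<Sum>j = 1..s. (lam j)\<^sup>2) / 16
                  * (1 / (theta X lam s 7)\<^sup>2 + 1 / (2 * ln (2 * real CARD('p)))))
       \<and> (\<forall>\<beta>star. f = X *v \<beta>star \<and> l0 \<beta>star \<le> s \<longrightarrow>
            integrable M (\<lambda>\<omega>. (norm (bhat \<omega> - \<beta>star))\<^sup>2) \<and>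
            (\<integral>\<omega>. (norm (bhat \<omega> - \<beta>star))\<^sup>2 \<partial>M)
              \<le> 9 * (\<Sum>j = 1..s. (lam j)\<^sup>2) / 4
                * (1 / (theta X lam s 3) ^ 4 + 1 / (ln (2 * real CARD('p)))\<^sup>2))"
proof -
  interpret prob_space M by fact
  note [measurable] = \<open>bhat \<in> borel_measurable M\<close>
  define z where "z = (\<lambda>\<omega>. \<xi> \<omega> /\<^sub>R \<sigma>)"
  define T where "T = (\<lambda>\<omega>. (infdist (z \<omega>) (tame_noise X))\<^sup>2 / 2)"
  define \<Lambda> where "\<Lambda> = ln (2 * real CARD('p))"
  define S where "S = (\<Sum>j = 1..s. (lam j)\<^sup>2)"
  have \<Lambda>: "0 < \<Lambda>" unfolding \<Lambda>_def by (rule ln_twice_card_pos)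
  have S: "0 \<le> S" by (simp add: S_def sum_nonneg)
  have lam: "lam j = A * \<sigma> / sqrt (real CARD('n)) * order_weight TYPE('p) j" if "j \<in> {1..CARD('p)}" for j
    using assms(6) that by (simp add: order_weight_def real_sqrt_divide)
  have "0 \<le> A" using assms(5) by (rule order_trans[rotated]) (simp add: add_nonneg_nonneg)
  then have w: "slope_weights TYPE('p) lam"
    using slope_weights_order_weight[where 'p='p] lam \<open>\<sigma> > 0\<close>
    by (auto simp: slope_weights_def intro!: mult_left_mono divide_right_mono)
  have X: "\<And>j. emp_norm (X *v axis j 1) \<le> 1" and \<theta>: "0 < theta X lam s 7"
    using assms(7) by (auto simp: WRE_def)
  have s: "1 \<le> s" "s \<le> CARD('p)" using assms(4) by auto
  have z: "gaussian_noise M 1 z"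
    unfolding z_def by (rule gaussian_noise_standardize) fact+
  have slope: "is_slope X lam (f + \<sigma> *\<^sub>R z \<omega>) (bhat \<omega>)" if "\<omega> \<in> space M" for \<omega>
    using assms(9) that \<open>\<sigma> > 0\<close> by (simp add: z_def)
  have moments: "integrable M T" "expectation T \<le> 1 / 2"
    "integrable M (\<lambda>\<omega>. (T \<omega>)\<^sup>2)" "expectation (\<lambda>\<omega>. (T \<omega>)\<^sup>2) \<le> 1"
    unfolding T_def by (rule tame_noise_distance_moments[OF assms(1) z X])+
  have [measurable]: "(\<lambda>v. sorted_l1 lam (v - \<beta>)) \<in> borel_measurable borel" for \<beta> :: "real ^ 'p"
    by (intro borel_measurable_continuous_onI continuous_on_compose2[OF continuous_on_sorted_l1[OF w]]
        continuous_intros) auto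
  have [measurable]: "(\<lambda>v. emp_norm (X *v v - f)) \<in> borel_measurable borel"
    unfolding emp_norm_eq by (intro borel_measurable_continuous_onI continuous_intros) auto
  have "integrable M (\<lambda>\<omega>. 1 / 2 * sorted_l1 lam (bhat \<omega> - \<beta>) + (emp_norm (X *v bhat \<omega> - f))\<^sup>2) \<and>
      (\<integral>\<omega>. 1 / 2 * sorted_l1 lam (bhat \<omega> - \<beta>) + (emp_norm (X *v bhat \<omega> - f))\<^sup>2 \<partial>M)
        \<le> (emp_norm (X *v \<beta> - f))\<^sup>2 + 49 / 16 * S * (1 / (theta X lam s 7)\<^sup>2 + 1 / 2 / \<Lambda>)"
    if \<beta>: "l0 \<beta> \<le> s" for \<beta>
  proof (rule expectation_le_by_affine_bound)
    show "0 \<le> 1 / 2 * sorted_l1 lam (bhat \<omega> - \<beta>) + (emp_norm (X *v bhat \<omega> - f))\<^sup>2" for \<omega>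
      using sorted_l1_nonneg[OF w] by simp
    show "1 / 2 * sorted_l1 lam (bhat \<omega> - \<beta>) + (emp_norm (X *v bhat \<omega> - f))\<^sup>2
        \<le> (emp_norm (X *v \<beta> - f))\<^sup>2 + 49 / 16 * S * (1 / (theta X lam s 7)\<^sup>2 + T \<omega> / \<Lambda>)"
      if "\<omega> \<in> space M" for \<omega>
      using slope_pathwise_bounds(1)[OF \<open>\<sigma> > 0\<close> assms(5) lam s \<theta> slope[OF that] \<beta>]
      by (simp add: T_def \<Lambda>_def S_def)
  qed (use moments S \<Lambda> in auto)
  moreover have "integrable M (\<lambda>\<omega>. (norm (bhat \<omega> - \<beta>))\<^sup>2) \<and>
      (\<integral>\<omega>. (norm (bhat \<omega> - \<beta>))\<^sup>2 \<partial>M) \<le> 0 + 9 / 4 * S * (1 / theta X lam s 3 ^ 4 + 1 / \<Lambda>\<^sup>2)"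
    if \<beta>: "f = X *v \<beta>" "l0 \<beta> \<le> s" for \<beta>
  proof (rule expectation_le_by_affine_bound)
    show "(norm (bhat \<omega> - \<beta>))\<^sup>2 \<le> 0 + 9 / 4 * S * (1 / theta X lam s 3 ^ 4 + (T \<omega>)\<^sup>2 / \<Lambda>\<^sup>2)"
      if "\<omega> \<in> space M" for \<omega>
      using slope_pathwise_bounds(2)[OF \<open>\<sigma> > 0\<close> assms(5) lam s \<theta> slope[OF that] \<beta>(2,1)]
      by (simp add: T_def \<Lambda>_def S_def power_divide)
  qed (use moments S \<Lambda> in auto)
  ultimately show ?thesis by (simp add: S_def \<Lambda>_def)
qed

end
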